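(* For $k\in\mathbb{N}_0=\{0,1,2,\dots\}$ let $u_k:\mathsf{SG}\to\mathbb{R}_{\ge0}$ be the odometer function of the divisible sandpile on the Sierpinski gasket graph $\mathsf{SG}$ with height function $h\equiv 1$ and initial mass distribution $\mu_0=3^{k+1}\delta_{(0,0)}$. Let $\psi_k:\mathbb{Z}^2\to\mathbb{Z}^2$ be given by $\psi_k(x,y)=(y,2^k-x-y)$. Then for all $k\in\mathbb{N}_0$ $$u_k(x,y)=\begin{cases}(\tilde u\circ\psi_k)(|x|,|y|), & \text{if } (x,y)\in B_{2^k},\\ 0, & \text{otherwise.}\end{cases}$$ Moreover, the sandpile cluster is $\{z\in\mathsf{SG}:u_k(z)>0\}=B_{2^k-1}$.
   Context: **Sierpinski gasket graph.** Let $G_0$ be the complete graph on the vertex set $\{(0,0),(1,0),(0,1)\}\subset\mathbb{Z}^2$. Recursively, $G_{k+1}$ is the union (of vertices and edges) of the three translates of $G_k$ by $(0,0)$, $(2^k,0)$ and $(0,2^k)$. Put $\mathsf{SG}^+=\bigcup_{k\ge0}G_k$, $\mathsf{SG}^-=-\mathsf{SG}^+$ (the image under $z\mapsto -z$), and $\mathsf{SG}=\mathsf{SG}^+\cup\mathsf{SG}^-$. This is an infinite 4-regular graph whose vertices are points of $\mathbb{Z}^2$; $\sim$ denotes adjacency. The ball of radius $n$ around $(0,0)$ in the graph metric is $B_n=\{(x,y)\in\mathsf{SG}:|x|+|y|\le n\}$. For a function $f$ let $\Delta f(x)=\frac14\sum_{y\sim x}f(y)-f(x)$. **The function $\tilde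 u$.** $\tilde u:\mathsf{SG}^+\to\mathbb{R}$ is the unique function with $\tilde u(x,0)=0$ for all $x\ge0$, $\tilde u(x,1)=2$ for all $x\ge0$ with $(x,1)\in\mathsf{SG}^+$, and $\Delta\tilde u(x,y)=1$ for all $(x,y)\in\mathsf{SG}^+$ with $y\ge1$ (for such vertices all four neighbours lie in $\mathsf{SG}^+$). **Divisible sandpile.** Let $h\equiv1$ be the height function and let $\mu_0:\mathsf{SG}\to\mathbb{R}_{\ge0}$ be a finitely supported initial sand distribution. The toppling operator is $T_x\mu=\mu+\max\{\mu(x)-h(x),0\}\,\Delta\delta_x$, where $\delta_x$ is the indicator function of $\{x\}$. Given a sequence $(x_j)_{j\ge1}$ of vertices containing every vertex infinitely often (a toppling sequence), the sand distribution after $j$ steps is $T_{x_j}\cdots T_{x_1}\mu_0$, and the odometer after $j$ steps assigns to $y$ the total mass emitted from $y$ during the first $j$ topplings. As $j\to\infty$, the odometers increase pointwise to a finite limit, called the odometer function, which does not depend on the toppling sequence. The sandpile cluster is the set of vertices where the odometer function is positive. *)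

theory Defs
  imports Complex_Main "HOL-Library.FuncSet" "HOL-Library.Product_Plus"
begin

type_synonym vertex = "int \<times> int"

section \<open>The Sierpinski gasket graph\<close>

definition shifts :: "nat \<Rightarrow> vertex set" where
  "shifts k = {(0, 0), (2 ^ k, 0), (0, 2 ^ k)}"

primrec G_verts :: "nat \<Rightarrow> vertex set" where
  "G_verts 0 = {(0, 0), (1, 0), (0, 1)}"
| "G_verts (Suc k) = (\<Union>t\<in>shifts k. (+) t ` G_verts k)"

text \<open>Edges are unordered pairs, represented as two-element sets of vertices.\<close>

primrec G_edges :: "nat \<Rightarrow> vertex set set" where
  "G_edges 0 = {{a, b} | a b. a \<in> G_verts 0 \<and> b \<in> G_verts 0 \<and> a \<noteq> b}"
| "G_edges (Suc k) = (\<Union>t\<in>shifts k. (\<lambda>e. (+) t ` e) ` G_edges k)"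

definition SG_plus :: "vertex set" where
  "SG_plus = (\<Union>k. G_verts k)"

definition SG_plus_edges :: "vertex set set" where
  "SG_plus_edges = (\<Union>k. G_edges k)"

definition SG :: "vertex set" where
  "SG = SG_plus \<union> uminus ` SG_plus"

definition SG_edges :: "vertex set set" where
  "SG_edges = SG_plus_edges \<union> (\<lambda>e. uminus ` e) ` SG_plus_edges"

definition SG_adj :: "vertex \<Rightarrow> vertex \<Rightarrow> bool" (infix "\<sim>" 50) where
  "x \<sim> y \<longleftrightarrow> {x, y} \<in> SG_edges"

text \<open>The ball of radius \<open>n\<close> around the origin in the graph metric, in coordinates; see
  \<open>SG_ball_eq_graph_ball\<close> below.\<close>

definition SG_ball :: "nat \<Rightarrow> vertex set" where
  "SG_ball n = {(x, y). (x, y) \<in> SG \<and> \<bar>x\<bar> + \<bar>y\<bar> \<le> int n}"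

definition laplacian :: "(vertex \<Rightarrow> real) \<Rightarrow> vertex \<Rightarrow> real" where
  "laplacian f x = 1 / 4 * (\<Sum>y | x \<sim> y. f y) - f x"

section \<open>The function \<open>\<tilde>u\<close>\<close>

text \<open>Functions on \<open>SG_plus\<close> are extensional functions on \<open>\<int>\<^sup>2\<close>. The Laplacian of the full graph
  \<open>SG\<close> may be used because all neighbours of \<open>(x, y)\<close> with \<open>y \<ge> 1\<close> lie in \<open>SG_plus\<close>.\<close>

definition u_tilde :: "vertex \<Rightarrow> real" where
  "u_tilde = (THE f. f \<in> SG_plus \<rightarrow>\<^sub>E UNIV \<and>
     (\<forall>x\<ge>0. f (x, 0) = 0) \<and>
     (\<forall>x\<ge>0. (x, 1) \<in> SG_plus \<longrightarrow> f (x, 1) = 2) \<and>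
     (\<forall>x y. (x, y) \<in> SG_plus \<and> y \<ge> 1 \<longrightarrow> laplacian f (x, y) = 1))"

section \<open>The divisible sandpile\<close>

definition excess :: "(vertex \<Rightarrow> real) \<Rightarrow> (vertex \<Rightarrow> real) \<Rightarrow> vertex \<Rightarrow> real" where
  "excess h \<mu> x = max (\<mu> x - h x) 0"

definition topple :: "(vertex \<Rightarrow> real) \<Rightarrow> vertex \<Rightarrow> (vertex \<Rightarrow> real) \<Rightarrow> vertex \<Rightarrow> real" where
  "topple h x \<mu> = (\<lambda>z. \<mu> z + excess h \<mu> x * laplacian (\<lambda>w. of_bool (w = x)) z)"

text \<open>Toppling sequences are indexed from \<open>0\<close>: the first vertex toppled is \<open>s 0\<close>.\<close>

definition toppling_sequence :: "(nat \<Rightarrow> vertex) \<Rightarrow> bool" where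
  "toppling_sequence s \<longleftrightarrow> range s \<subseteq> SG \<and> (\<forall>x\<in>SG. infinite {j. s j = x})"

primrec sand_after ::
  "(vertex \<Rightarrow> real) \<Rightarrow> (vertex \<Rightarrow> real) \<Rightarrow> (nat \<Rightarrow> vertex) \<Rightarrow> nat \<Rightarrow> vertex \<Rightarrow> real" where
  "sand_after h \<mu>0 s 0 = \<mu>0"
| "sand_after h \<mu>0 s (Suc j) = topple h (s j) (sand_after h \<mu>0 s j)"

definition odometer_after ::
  "(vertex \<Rightarrow> real) \<Rightarrow> (vertex \<Rightarrow> real) \<Rightarrow> (nat \<Rightarrow> vertex) \<Rightarrow> nat \<Rightarrow> vertex \<Rightarrow> real" where
  "odometer_after h \<mu>0 s j y =
     (\<Sum>i | i < j \<and> s i = y. excess h (sand_after h \<mu>0 s i) y)"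

text \<open>The description pins down the value because toppling sequences exist (\<open>SG\<close> is countable)
  and limits are unique.\<close>

definition odometer :: "(vertex \<Rightarrow> real) \<Rightarrow> (vertex \<Rightarrow> real) \<Rightarrow> vertex \<Rightarrow> real" where
  "odometer h \<mu>0 y =
     (THE l. \<forall>s. toppling_sequence s \<longrightarrow> (\<lambda>j. odometer_after h \<mu>0 s j y) \<longlonglongrightarrow> l)"

definition sandpile_cluster :: "(vertex \<Rightarrow> real) \<Rightarrow> (vertex \<Rightarrow> real) \<Rightarrow> vertex set" where
  "sandpile_cluster h \<mu>0 = {z \<in> SG. odometer h \<mu>0 z > 0}"

definition initial_mass :: "nat \<Rightarrow> vertex \<Rightarrow> real" where
  "initial_mass k = (\<lambda>z. 3 ^ (k + 1) * of_bool (z = (0, 0)))"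

definition \<psi> :: "nat \<Rightarrow> vertex \<Rightarrow> vertex" where
  "\<psi> k = (\<lambda>(x, y). (y, 2 ^ k - x - y))"

section \<open>Balls in the graph metric\<close>

lemma G_verts_SucI: "t \<in> shifts k \<Longrightarrow> v \<in> G_verts k \<Longrightarrow> t + v \<in> G_verts (Suc k)"
  by auto

lemma G_verts_SucE:
  assumes "z \<in> G_verts (Suc k)"
  obtains t v where "t \<in> shifts k" "v \<in> G_verts k" "z = t + v"
  using assms by auto

lemma G_edges_SucI:
  assumes "t \<in> shifts k" "{a, b} \<in> G_edges k"
  shows "{t + a, t + b} \<in> G_edges (Suc k)"
proof -
  have "{t + a, t + b} = (+) t ` {a, b}" by simp
  with assms show ?thesis unfolding G_edges.simps by blast
qed

lemma zero_in_G_verts: "(0, 0) \<in> G_verts k"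
proof (induction k)
  case (Suc k)
  have "(0, 0) \<in> shifts k" by (simp add: shifts_def)
  from G_verts_SucI[OF this Suc] show ?case by (simp only: add_Pair) simp
qed simp

lemma G_verts_nonneg: "z \<in> G_verts k \<Longrightarrow> 0 \<le> fst z \<and> 0 \<le> snd z"
proof (induction k arbitrary: z)
  case (Suc k)
  obtain t v where tv: "t \<in> shifts k" "v \<in> G_verts k" "z = t + v"
    using Suc.prems by (rule G_verts_SucE)
  then have "0 \<le> fst t \<and> 0 \<le> snd t" by (auto simp: shifts_def)
  with Suc.IH[OF tv(2)] tv(3) show ?case by simp
qed auto

lemma G_corners: "(2 ^ k, 0) \<in> G_verts k \<and> (0, 2 ^ k) \<in> G_verts k"
proof (induction k)
  case (Suc k)
  have "(2 ^ k, 0) \<in> shifts k" "(0, 2 ^ k) \<in> shifts k" by (simp_all add: shifts_def)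
  with Suc have "(2 ^ k, 0) + (2 ^ k, 0) \<in> G_verts (Suc k)" "(0, 2 ^ k) + (0, 2 ^ k) \<in> G_verts (Suc k)"
    by (blast intro: G_verts_SucI)+
  then show ?case by (simp only: add_Pair) (simp del: G_verts.simps)
qed simp

lemma G_edges_step:
  assumes "{a, b} \<in> G_edges k"
  shows "a \<in> G_verts k \<and> b \<in> G_verts k \<and> \<bar>fst a + snd a - (fst b + snd b)\<bar> \<le> 1"
  using assms
proof (induction k arbitrary: a b)
  case 0
  then show ?case by (auto simp: doubleton_eq_iff)
next
  case (Suc k)
  then obtain t e where te: "t \<in> shifts k" "e \<in> G_edges k" "{a, b} = (+) t ` e"
    by auto
  have "e = (+) (- t) ` (+) t ` e" by (simp add: image_image)
  then have "e = {- t + a, - t + b}" unfolding te(3)[symmetric] by simp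
  then have e: "{- t + a, - t + b} \<in> G_edges k" using te(2) by simp
  note IH = Suc.IH[OF this]
  have "t + (- t + a) \<in> G_verts (Suc k)" "t + (- t + b) \<in> G_verts (Suc k)"
    using IH te(1) by (blast intro: G_verts_SucI)+
  then have "a \<in> G_verts (Suc k)" "b \<in> G_verts (Suc k)"
    by (simp_all del: G_verts.simps)
  moreover have "fst a + snd a - (fst b + snd b) =
      fst (- t + a) + snd (- t + a) - (fst (- t + b) + snd (- t + b))"
    by simp
  ultimately show ?case using IH by metis
qed

lemma G_pred:
  assumes "z \<in> G_verts k" "z \<noteq> (0, 0)"
  shows "\<exists>w \<in> G_verts k. {w, z} \<in> G_edges k \<and> fst w + snd w = fst z + snd z - 1"
  using assms
proof (induction k arbitrary: z)
  case 0
  then have "{(0, 0), z} \<in> G_edges 0" unfolding G_edges.simps by auto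
  moreover have "fst z + snd z = 1" using 0 by auto
  moreover have "(0, 0) \<in> G_verts 0" by (rule zero_in_G_verts)
  ultimately show ?case by (intro bexI[of _ "(0, 0)"]) (simp_all del: G_verts.simps G_edges.simps)
next
  case (Suc k)
  have "\<exists>t v. t \<in> shifts k \<and> v \<in> G_verts k \<and> z = t + v \<and> v \<noteq> (0, 0)"
  proof -
    obtain t v where tv: "t \<in> shifts k" "v \<in> G_verts k" "z = t + v"
      using Suc.prems(1) by (rule G_verts_SucE)
    show ?thesis
    proof (cases "v = (0, 0)")
      case True
      then have z: "z = t" using tv by (simp add: prod_eq_iff)
      then have "t = (2 ^ k, 0) \<or> t = (0, 2 ^ k)"
        using tv(1) Suc.prems(2) by (auto simp: shifts_def)
      then have "z \<in> G_verts k" using G_corners z by blast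
      moreover have "z = (0, 0) + z" by (simp add: prod_eq_iff)
      moreover have "(0, 0) \<in> shifts k" by (simp add: shifts_def)
      ultimately show ?thesis using Suc.prems(2) by blast
    qed (use tv in blast)
  qed
  then obtain t v where tv: "t \<in> shifts k" "v \<in> G_verts k" "z = t + v" "v \<noteq> (0, 0)"
    by blast
  from Suc.IH[OF tv(2,4)] obtain w where
    w: "w \<in> G_verts k" "{w, v} \<in> G_edges k" "fst w + snd w = fst v + snd v - 1"
    by blast
  have "t + w \<in> G_verts (Suc k)" using tv(1) w(1) by (rule G_verts_SucI)
  moreover have "{t + w, z} \<in> G_edges (Suc k)"
    unfolding tv(3) using tv(1) w(2) by (rule G_edges_SucI)
  moreover have "fst (t + w) + snd (t + w) = fst z + snd z - 1"
    using tv(3) w(3) by simp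
  ultimately show ?case by blast
qed

lemma SG_plus_edges_step:
  assumes "{a, b} \<in> SG_plus_edges"
  shows "a \<in> SG_plus \<and> b \<in> SG_plus \<and>
    \<bar>\<bar>fst a\<bar> + \<bar>snd a\<bar> - (\<bar>fst b\<bar> + \<bar>snd b\<bar>)\<bar> \<le> 1"
proof -
  obtain k where k: "{a, b} \<in> G_edges k" using assms by (auto simp: SG_plus_edges_def)
  from G_edges_step[OF k] show ?thesis
    using G_verts_nonneg[of a k] G_verts_nonneg[of b k]
    by (auto simp: SG_plus_def)
qed

lemma uminus_edge:
  assumes "{a, b} = uminus ` e"
  shows "e = {- a, - b :: vertex}"
proof -
  have "e = uminus ` uminus ` e" by (simp add: image_image)
  then show ?thesis unfolding assms[symmetric] by simp
qed

lemma SG_adj_step: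
  assumes "a \<sim> b"
  shows "a \<in> SG \<and> b \<in> SG \<and> \<bar>\<bar>fst a\<bar> + \<bar>snd a\<bar> - (\<bar>fst b\<bar> + \<bar>snd b\<bar>)\<bar> \<le> 1"
proof (cases "{a, b} \<in> SG_plus_edges")
  case True
  then show ?thesis using SG_plus_edges_step by (auto simp: SG_def)
next
  case False
  then obtain e where "e \<in> SG_plus_edges" "{a, b} = uminus ` e"
    using assms by (auto simp: SG_adj_def SG_edges_def)
  then have "{- a, - b} \<in> SG_plus_edges" using uminus_edge by metis
  note step = SG_plus_edges_step[OF this]
  have "a = - (- a)" "b = - (- b)" by simp_all
  then have "a \<in> SG" "b \<in> SG" using step unfolding SG_def by blast+
  with step show ?thesis by simp
qed

lemma SG_pred:
  assumes "z \<in> SG" "z \<noteq> (0, 0)"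
  shows "\<exists>w. w \<sim> z \<and> \<bar>fst w\<bar> + \<bar>snd w\<bar> = \<bar>fst z\<bar> + \<bar>snd z\<bar> - 1"
proof -
  have *: "\<exists>w. {w, v} \<in> SG_plus_edges \<and> \<bar>fst w\<bar> + \<bar>snd w\<bar> = \<bar>fst v\<bar> + \<bar>snd v\<bar> - 1"
    if v: "v \<in> SG_plus" "v \<noteq> (0, 0)" for v
  proof -
    obtain k where k: "v \<in> G_verts k" using v by (auto simp: SG_plus_def)
    obtain w where w: "w \<in> G_verts k" "{w, v} \<in> G_edges k" "fst w + snd w = fst v + snd v - 1"
      using G_pred[OF k v(2)] by blast
    then show ?thesis
      using G_verts_nonneg[of w k] G_verts_nonneg[of v k] k
      by (intro exI[of _ w]) (auto simp: SG_plus_edges_def)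
  qed
  show ?thesis
  proof (cases "z \<in> SG_plus")
    case True
    then show ?thesis using * assms unfolding SG_adj_def SG_edges_def by blast
  next
    case False
    then have "- z \<in> SG_plus" "- z \<noteq> (0, 0)"
      using assms by (auto simp: SG_def prod_eq_iff)
    then obtain w where w: "{w, - z} \<in> SG_plus_edges"
      "\<bar>fst w\<bar> + \<bar>snd w\<bar> = \<bar>fst (- z)\<bar> + \<bar>snd (- z)\<bar> - 1"
      using * by blast
    have "{- w, z} = uminus ` {w, - z}" by simp
    then have "- w \<sim> z" using w(1) unfolding SG_adj_def SG_edges_def by blast
    then show ?thesis using w(2) by (intro exI[of _ "- w"]) auto
  qed
qed

lemma SG_ball_eq_graph_ball: "SG_ball n = {z. \<exists>m\<le>n. (SG_adj ^^ m) (0, 0) z}"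
proof (intro equalityI subsetI)
  fix z assume "z \<in> SG_ball n"
  then have "z \<in> SG" "\<bar>fst z\<bar> + \<bar>snd z\<bar> \<le> int n" by (auto simp: SG_ball_def)
  then have "\<exists>m\<le>n. (SG_adj ^^ m) (0, 0) z"
  proof (induction n arbitrary: z)
    case 0
    then have "z = (0, 0)" by (auto simp: prod_eq_iff)
    then show ?case by auto
  next
    case (Suc n)
    show ?case
    proof (cases "z = (0, 0)")
      case True
      then show ?thesis by (intro exI[of _ 0]) auto
    next
      case False
      then obtain w where w: "w \<sim> z" "\<bar>fst w\<bar> + \<bar>snd w\<bar> = \<bar>fst z\<bar> + \<bar>snd z\<bar> - 1"
        using SG_pred Suc.prems by blast
      then obtain m where "m \<le> n" "(SG_adj ^^ m) (0, 0) w"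
        using Suc.IH[of w] Suc.prems SG_adj_step[OF w(1)] by auto
      then show ?thesis using w(1) by (intro exI[of _ "Suc m"]) auto
    qed
  qed
  then show "z \<in> {z. \<exists>m\<le>n. (SG_adj ^^ m) (0, 0) z}" by simp
next
  fix z assume "z \<in> {z. \<exists>m\<le>n. (SG_adj ^^ m) (0, 0) z}"
  then obtain m where m: "m \<le> n" "(SG_adj ^^ m) (0, 0) z" by blast
  have "z \<in> SG \<and> \<bar>fst z\<bar> + \<bar>snd z\<bar> \<le> int m"
    using m(2)
  proof (induction m arbitrary: z)
    case 0
    then show ?case using zero_in_G_verts by (auto simp: SG_def SG_plus_def)
  next
    case (Suc m)
    then obtain w where "(SG_adj ^^ m) (0, 0) w" "w \<sim> z" by auto
    then show ?case using Suc.IH[of w] SG_adj_step[of w z] by auto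
  qed
  with m(1) show "z \<in> SG_ball n" by (auto simp: SG_ball_def)
qed

end

theory Submission
  imports Defs "HOL-Library.Countable_Set"
begin

text \<open>
  The odometer is characterised by an obstacle problem: it is the only function \<open>w \<ge> 0\<close> on \<open>SG\<close>
  with finite support such that \<open>\<mu>\<^sub>0 + \<Delta>w \<le> h\<close> everywhere, with equality where \<open>w > 0\<close>
  (\<open>odometer_eqI\<close>). One inequality is the least action principle: a toppling never overshoots a
  stabilising \<open>w\<close>, so the odometers increase to a limit \<open>u \<le> w\<close>. Each vertex is stable right after
  each of its infinitely many topplings, so \<open>u\<close> stabilises too; hence \<open>w - u\<close> is subharmonic on the
  support of \<open>w\<close> and vanishes off it, and the maximum principle gives \<open>w = u\<close>. It
  remains to see that the function in the theorem solves this obstacle problem.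

  This rests on the decimation of the equation \<open>\<Delta>f = 1\<close> on a copy of \<open>G\<^sub>n\<close>. A solution with
  corner values \<open>a\<close>, \<open>b\<close>, \<open>c\<close> has, at the corner with value \<open>a\<close>, the flux (sum of the
  differences along the two edges inside the copy) \<open>(3/5)\<^sup>n (b + c - 2a) - 2(3\<^sup>n - 1)\<close>
  (\<open>poisson_imp_flux_law\<close>). At each of the three midpoints of a copy of \<open>G\<^sub>n\<^sub>+\<^sub>1\<close> two fluxes of
  subcopies must add up to \<open>4\<close>. This linear system forces the midpoint of the
  \<open>a\<close>-\<open>b\<close> side to have the value \<open>(2a + 2b + c)/5 - 2\<cdot>5\<^sup>n\<close>, which in turn yields
  the flux law one level up. Iterating the midpoint rule gives the solution for arbitrary corner values
  (\<open>dirichlet\<close>).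

  For the corner values \<open>0, 0, 2\<cdot>5\<^sup>n\<^sup>+\<^sup>1\<close> the midpoint rule gives the value \<open>0\<close> at the bottom midpoint and
  \<open>2\<cdot>5\<^sup>n\<close> at the other two. So the two lower subcopies repeat the pattern; the solutions on
  \<open>G\<^sub>0, G\<^sub>1, \<dots>\<close> extend each other, vanish on row \<open>0\<close> and equal \<open>2\<close> on row \<open>1\<close>. Conversely,
  these two rows determine a solution: the flux balance at the left midpoint
  determines the value at the apex, one scale after the other (\<open>tent_unique\<close>). This identifies \<open>\<tilde>u\<close>.

  The map \<open>\<psi> k\<close> rotates \<open>G\<^sub>k\<close>, so \<open>\<tilde>u \<circ> \<psi> k\<close> is the solution with value \<open>2\<cdot>5\<^sup>k\<close> at the
  origin and \<open>0\<close> on the opposite side. By the flux law its two copies contribute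
  \<open>2(2 - 2\<cdot>3\<^sup>k\<^sup>+\<^sup>1) = 4(1 - 3\<^sup>k\<^sup>+\<^sup>1)\<close> at the origin, which cancels all but one unit of the initial mass,
  while each far corner receives \<open>2/4 = 1/2 \<le> 1\<close>.
\<close>

section \<open>Cells of the gasket\<close>

text \<open>A cell is a unit triangle of the gasket, and \<open>cells n\<close> collects the lower left corners of the
  cells of \<open>G\<^sub>n\<close>. Vertices and edges of the gasket are easily read off from these positions, whose
  binary digits are governed by \<open>cells_Suc_iff_halves\<close> below.\<close>
primrec cells :: "nat \<Rightarrow> vertex set" where
  "cells 0 = {(0, 0)}"
| "cells (Suc n) = (\<Union>t\<in>shifts n. (+) t ` cells n)"

definition all_cells :: "vertex set" where
  "all_cells = (\<Union>n. cells n)"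

definition cell :: "vertex \<Rightarrow> vertex set" where
  "cell c = {c, c + (1, 0), c + (0, 1)}"

lemma mem_cell_iff: "(x, y) \<in> cell (a, b) \<longleftrightarrow> (a, b) \<in> {(x, y), (x - 1, y), (x, y - 1)}"
  by (auto simp: cell_def)

lemma translate_cell: "(+) t ` cell c = cell (t + c)"
  by (simp add: cell_def add.assoc)

lemma translate_mem_iff: "(x, y) \<in> (+) (p, q) ` A \<longleftrightarrow> (x - p, y - q) \<in> (A :: vertex set)"
  by (force simp: image_iff)

lemma cells_Suc_iff:
  "(x, y) \<in> cells (Suc n) \<longleftrightarrow>
     (x, y) \<in> cells n \<or> (x - 2 ^ n, y) \<in> cells n \<or> (x, y - 2 ^ n) \<in> cells n"
  by (simp add: shifts_def translate_mem_iff)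

lemma G_verts_Suc_iff:
  "(x, y) \<in> G_verts (Suc n) \<longleftrightarrow>
     (x, y) \<in> G_verts n \<or> (x - 2 ^ n, y) \<in> G_verts n \<or> (x, y - 2 ^ n) \<in> G_verts n"
  by (simp add: shifts_def translate_mem_iff)

declare cells.simps(2) [simp del] G_verts.simps(2) [simp del] G_edges.simps(2) [simp del]

lemma G_verts_eq_cells: "G_verts n = (\<Union>c\<in>cells n. cell c)"
proof (induction n)
  case 0
  show ?case by (simp add: cell_def)
next
  case (Suc n)
  have "G_verts (Suc n) = (\<Union>t\<in>shifts n. \<Union>c\<in>cells n. cell (t + c))"
    by (simp add: G_verts.simps Suc image_UN translate_cell)
  then show ?case by (auto simp: cells.simps)
qed

lemma G_edges_iff:
  "e \<in> G_edges n \<longleftrightarrow> (\<exists>c\<in>cells n. \<exists>a\<in>cell c. \<exists>b\<in>cell c. a \<noteq> b \<and> e = {a, b})"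
proof (induction n arbitrary: e)
  case 0
  have "G_verts 0 = cell (0, 0)" by (simp add: cell_def)
  then show ?case unfolding G_edges.simps(1) cells.simps(1) by blast
next
  case (Suc n)
  have "e \<in> G_edges (Suc n) \<longleftrightarrow>
      (\<exists>t\<in>shifts n. \<exists>c\<in>cells n. \<exists>a\<in>cell c. \<exists>b\<in>cell c. a \<noteq> b \<and> e = (+) t ` {a, b})"
    unfolding G_edges.simps(2) UN_iff image_iff[of e] Bex_def[of "G_edges n"] Suc.IH by blast
  also have "\<dots> \<longleftrightarrow> (\<exists>t\<in>shifts n. \<exists>c\<in>cells n. \<exists>a\<in>cell (t + c). \<exists>b\<in>cell (t + c). a \<noteq> b \<and> e = {a, b})"
    by (simp add: translate_cell[symmetric])
  also have "\<dots> \<longleftrightarrow> (\<exists>c\<in>cells (Suc n). \<exists>a\<in>cell c. \<exists>b\<in>cell c. a \<noteq> b \<and> e = {a, b})"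
    by (auto simp: cells.simps)
  finally show ?case .
qed

lemma SG_plus_eq_cells: "SG_plus = (\<Union>c\<in>all_cells. cell c)"
  by (auto simp: SG_plus_def all_cells_def G_verts_eq_cells)

lemma SG_plus_edges_iff:
  "{x, y} \<in> SG_plus_edges \<longleftrightarrow> x \<noteq> y \<and> (\<exists>c\<in>all_cells. x \<in> cell c \<and> y \<in> cell c)"
  by (auto simp: SG_plus_edges_def G_edges_iff all_cells_def doubleton_eq_iff)

lemma SG_adj_iff:
  "x \<sim> y \<longleftrightarrow> {x, y} \<in> SG_plus_edges \<or> {- x, - y} \<in> SG_plus_edges"
proof -
  have "{x, y} \<in> (\<lambda>e. uminus ` e) ` SG_plus_edges \<longleftrightarrow> {- x, - y} \<in> SG_plus_edges"
  proof
    assume "{- x, - y} \<in> SG_plus_edges"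
    moreover have "{x, y} = uminus ` {- x, - y}" by simp
    ultimately show "{x, y} \<in> (\<lambda>e. uminus ` e) ` SG_plus_edges" by blast
  qed (auto dest: uminus_edge)
  then show ?thesis by (simp add: SG_adj_def SG_edges_def)
qed

text \<open>The recursion of \<open>cells\<close> adds a leading binary digit to the coordinates; this is the same
  set built by appending a trailing digit. In other words, \<open>(x, y)\<close> is the position of a cell iff \<open>x\<close>
  and \<open>y\<close> have no common binary digit \<open>1\<close>.\<close>
lemma cells_Suc_iff_halves:
  "(x, y) \<in> cells (Suc n) \<longleftrightarrow> (x div 2, y div 2) \<in> cells n \<and> \<not> (odd x \<and> odd y)"
proof (induction n arbitrary: x y)
  case 0
  show ?case by (simp add: cells_Suc_iff) presburger
next
  case (Suc n)
  have half: "(z - 2 ^ Suc n) div 2 = z div 2 - 2 ^ n" for z :: int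
    by simp
  have "(x, y) \<in> cells (Suc (Suc n)) \<longleftrightarrow> (x, y) \<in> cells (Suc n) \<or>
      (x - 2 ^ Suc n, y) \<in> cells (Suc n) \<or> (x, y - 2 ^ Suc n) \<in> cells (Suc n)"
    by (rule cells_Suc_iff)
  also have "\<dots> \<longleftrightarrow> ((x div 2, y div 2) \<in> cells n \<or> (x div 2 - 2 ^ n, y div 2) \<in> cells n
      \<or> (x div 2, y div 2 - 2 ^ n) \<in> cells n) \<and> \<not> (odd x \<and> odd y)"
    unfolding Suc.IH half by auto
  also have "\<dots> \<longleftrightarrow> (x div 2, y div 2) \<in> cells (Suc n) \<and> \<not> (odd x \<and> odd y)"
    unfolding cells_Suc_iff ..
  finally show ?case .
qed

text \<open>A point can belong only to the cells at \<open>(x, y)\<close>, \<open>(x - 1, y)\<close> and \<open>(x, y - 1)\<close>, so this is the upper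
  bound \<open>2\<close> on the number of cells that meet at a vertex. Halving the coordinates reduces the
  claim when both are even; otherwise one of the three positions has two odd coordinates.\<close>
lemma not_three_cells:
  "\<not> ((x, y) \<in> cells n \<and> (x - 1, y) \<in> cells n \<and> (x, y - 1) \<in> cells n)"
proof (induction n arbitrary: x y)
  case (Suc n)
  have half: "(z - 1) div 2 = z div 2 - 1" if "even z" for z :: int
    using that by presburger
  show ?case
  proof (cases "even x \<and> even y")
    case True
    then show ?thesis
      using Suc.IH[of "x div 2" "y div 2"] by (auto simp: cells_Suc_iff_halves half)
  next
    case False
    then show ?thesis by (auto simp: cells_Suc_iff_halves)
  qed
qed auto

lemma cells_mono: "m \<le> n \<Longrightarrow> cells m \<subseteq> cells n"
  by (rule lift_Suc_mono_le) (auto simp: cells_Suc_iff)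

lemma G_verts_mono: "m \<le> n \<Longrightarrow> G_verts m \<subseteq> G_verts n"
  unfolding G_verts_eq_cells using cells_mono by blast

lemma not_three_all_cells:
  "\<not> ((x, y) \<in> all_cells \<and> (x - 1, y) \<in> all_cells \<and> (x, y - 1) \<in> all_cells)"
proof
  assume "(x, y) \<in> all_cells \<and> (x - 1, y) \<in> all_cells \<and> (x, y - 1) \<in> all_cells"
  then obtain i j l where "(x, y) \<in> cells i" "(x - 1, y) \<in> cells j" "(x, y - 1) \<in> cells l"
    by (auto simp: all_cells_def)
  moreover have "i \<le> i + j + l" "j \<le> i + j + l" "l \<le> i + j + l" by simp_all
  ultimately show False
    using not_three_cells[of x y "i + j + l"] cells_mono by (meson subsetD)
qed

lemma all_cells_nonneg: "(a, b) \<in> all_cells \<Longrightarrow> 0 \<le> a \<and> 0 \<le> b"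
  using G_verts_nonneg[of "(a, b)"] by (force simp: all_cells_def G_verts_eq_cells cell_def)

lemma SG_plus_nonneg: "(x, y) \<in> SG_plus \<Longrightarrow> 0 \<le> x \<and> 0 \<le> y"
  using G_verts_nonneg[of "(x, y)"] by (auto simp: SG_plus_def)

text \<open>The cells in the three corners of \<open>G\<^sub>n\<close>.\<close>
lemma corner_cells: "(0, 0) \<in> cells n \<and> (2 ^ n - 1, 0) \<in> cells n \<and> (0, 2 ^ n - 1) \<in> cells n"
proof (induction n)
  case (Suc n)
  have "2 ^ Suc n - 1 - 2 ^ n = (2 ^ n - 1 :: int)" by simp
  then show ?case using Suc by (simp add: cells_Suc_iff)
qed simp

lemma axis_in_all_cells:
  assumes "0 \<le> x"
  shows "(x, 0) \<in> all_cells"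
proof -
  have "0 \<le> x \<Longrightarrow> x < 2 ^ n \<Longrightarrow> (x, 0) \<in> cells n" for n
  proof (induction n arbitrary: x)
    case (Suc n)
    show ?case
    proof (cases "x < 2 ^ n")
      case False
      then show ?thesis using Suc.IH[of "x - 2 ^ n"] Suc.prems by (simp add: cells_Suc_iff)
    qed (use Suc in \<open>simp add: cells_Suc_iff\<close>)
  qed simp
  moreover have "int (nat x) < 2 ^ nat x" by (rule of_nat_less_two_power)
  ultimately have "(x, 0) \<in> cells (nat x)" using assms by simp
  then show ?thesis unfolding all_cells_def by blast
qed

lemma G_verts_bound: "(x, y) \<in> G_verts n \<Longrightarrow> 0 \<le> x \<and> 0 \<le> y \<and> x + y \<le> 2 ^ n"
proof (induction n arbitrary: x y)
  case (Suc n)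
  then have "x + y \<le> 2 ^ n + 2 ^ n"
    unfolding G_verts_Suc_iff by (force dest: Suc.IH)
  then show ?case using G_verts_nonneg[OF Suc.prems] by simp
qed auto

lemma G_verts_SucD:
  assumes "(x, y) \<in> G_verts (Suc n)" "x + y \<le> 2 ^ n"
  shows "(x, y) \<in> G_verts n"
proof -
  have "(x, y) \<in> G_verts n" if "(x - 2 ^ n, y) \<in> G_verts n"
  proof -
    have "x = 2 ^ n" "y = 0" using G_verts_bound[OF that] assms(2) by auto
    then show ?thesis using G_corners by simp
  qed
  moreover have "(x, y) \<in> G_verts n" if "(x, y - 2 ^ n) \<in> G_verts n"
  proof -
    have "x = 0" "y = 2 ^ n" using G_verts_bound[OF that] assms(2) by auto
    then show ?thesis using G_corners by simp
  qed
  ultimately show ?thesis using assms(1) by (auto simp: G_verts_Suc_iff)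
qed

text \<open>\<open>G\<^sub>n\<close> meets the rest of the gasket only on the line \<open>x + y = 2\<^sup>n\<close>, so no later step of the
  construction adds a vertex on or below that line.\<close>
lemma SG_plus_bounded_in_G_verts:
  assumes "(x, y) \<in> SG_plus" "x + y \<le> 2 ^ k"
  shows "(x, y) \<in> G_verts k"
proof -
  obtain n where n: "(x, y) \<in> G_verts n" using assms(1) by (auto simp: SG_plus_def)
  have "(x, y) \<in> G_verts (k + m) \<Longrightarrow> (x, y) \<in> G_verts k" for m
  proof (induction m)
    case (Suc m)
    have "(2 :: int) ^ k \<le> 2 ^ (k + m)" by (rule power_increasing) simp_all
    with assms(2) have "x + y \<le> 2 ^ (k + m)" by (rule order_trans)
    then show ?case using Suc G_verts_SucD[of x y "k + m"] by simp
  qed simp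
  moreover have "(x, y) \<in> G_verts (k + n)" using n G_verts_mono[of n "k + n"] by auto
  ultimately show ?thesis by blast
qed

section \<open>Neighbours\<close>

lemma not_adj_self: "\<not> x \<sim> x"
  by (simp add: SG_adj_iff SG_plus_edges_iff del: insert_absorb2)

lemma adj_uminus: "- x \<sim> - y \<longleftrightarrow> x \<sim> y"
  by (auto simp: SG_adj_iff)

lemma nbrs_uminus: "{y. - x \<sim> y} = uminus ` {y. x \<sim> y}"
proof -
  have "y \<in> uminus ` {y. x \<sim> y}" if "- x \<sim> y" for y
  proof -
    have "x \<sim> - y" using that adj_uminus[of x "- y"] by simp
    then show ?thesis by (intro image_eqI[of _ _ "- y"]) auto
  qed
  moreover have "uminus ` {y. x \<sim> y} \<subseteq> {y. - x \<sim> y}" using adj_uminus by blast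
  ultimately show ?thesis by blast
qed

lemma laplacian_uminus: "laplacian f (- x) = laplacian (\<lambda>z. f (- z)) x"
  by (simp add: laplacian_def nbrs_uminus sum.reindex)

lemma adj_SG_plus_iff:
  assumes "0 \<le> x" "0 \<le> y" "(x, y) \<noteq> (0, 0)"
  shows "(x, y) \<sim> w \<longleftrightarrow>
    w \<noteq> (x, y) \<and> (\<exists>c\<in>all_cells \<inter> {(x, y), (x - 1, y), (x, y - 1)}. w \<in> cell c)"
proof -
  have "{- (x, y), - w} \<notin> SG_plus_edges"
    using SG_plus_edges_step[of "- (x, y)" "- w"] SG_plus_nonneg[of "- x" "- y"] assms by auto
  then have "(x, y) \<sim> w \<longleftrightarrow> w \<noteq> (x, y) \<and> (\<exists>c\<in>all_cells. (x, y) \<in> cell c \<and> w \<in> cell c)"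
    by (auto simp: SG_adj_iff SG_plus_edges_iff)
  moreover have "(x, y) \<in> cell c \<longleftrightarrow> c \<in> {(x, y), (x - 1, y), (x, y - 1)}" for c
    by (cases c) (simp only: mem_cell_iff)
  ultimately show ?thesis by blast
qed

text \<open>Two cells meet at a vertex other than the origin, in one of three relative positions. The
  names of the next three lemmas refer to the side of a larger triangle of which the vertex is the midpoint.\<close>
lemma nbrs_bottom:
  assumes "(x, y) \<in> all_cells" "(x - 1, y) \<in> all_cells"
  shows "{w. (x, y) \<sim> w} = {(x + 1, y), (x, y + 1), (x - 1, y), (x - 1, y + 1)}"
proof -
  have "(x, y - 1) \<notin> all_cells" using assms not_three_all_cells by blast
  moreover have "0 \<le> x" "0 \<le> y" "(x, y) \<noteq> (0, 0)" using all_cells_nonneg[OF assms(2)] by auto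
  ultimately show ?thesis
    using assms by (auto simp: adj_SG_plus_iff cell_def)
qed

lemma nbrs_left:
  assumes "(x, y) \<in> all_cells" "(x, y - 1) \<in> all_cells"
  shows "{w. (x, y) \<sim> w} = {(x + 1, y), (x, y + 1), (x, y - 1), (x + 1, y - 1)}"
proof -
  have "(x - 1, y) \<notin> all_cells" using assms not_three_all_cells by blast
  moreover have "0 \<le> x" "0 \<le> y" "(x, y) \<noteq> (0, 0)" using all_cells_nonneg[OF assms(2)] by auto
  ultimately show ?thesis
    using assms by (auto simp: adj_SG_plus_iff cell_def)
qed

lemma nbrs_right:
  assumes "(x - 1, y) \<in> all_cells" "(x, y - 1) \<in> all_cells"
  shows "{w. (x, y) \<sim> w} = {(x - 1, y), (x - 1, y + 1), (x, y - 1), (x + 1, y - 1)}"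
proof -
  have "(x, y) \<notin> all_cells" using assms not_three_all_cells by blast
  moreover have "0 \<le> x" "0 \<le> y" "(x, y) \<noteq> (0, 0)"
    using all_cells_nonneg[OF assms(1)] all_cells_nonneg[OF assms(2)] by auto
  ultimately show ?thesis
    using assms by (auto simp: adj_SG_plus_iff cell_def)
qed

lemma zero_in_all_cells: "(0, 0) \<in> all_cells"
  using corner_cells unfolding all_cells_def by blast

lemma nbrs_zero: "{w. (0, 0) \<sim> w} = {(1, 0), (0, 1), (-1, 0), (0, -1)}"
proof -
  have cells: "{c \<in> all_cells. (0, 0) \<in> cell c} = {(0, 0)}"
    using zero_in_all_cells by (auto simp: mem_cell_iff dest: all_cells_nonneg)
  have pos: "{(0, 0), w} \<in> SG_plus_edges \<longleftrightarrow> w \<in> {(1, 0), (0, 1)}" for w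
  proof -
    have "{(0, 0), w} \<in> SG_plus_edges \<longleftrightarrow> w \<noteq> (0, 0) \<and> (\<exists>c\<in>{c \<in> all_cells. (0, 0) \<in> cell c}. w \<in> cell c)"
      by (auto simp: SG_plus_edges_iff)
    then show ?thesis unfolding cells by (auto simp: cell_def)
  qed
  have "(0, 0) \<sim> w \<longleftrightarrow> w \<in> {(1, 0), (0, 1)} \<or> - w \<in> {(1, 0), (0, 1)}" for w
    using pos[of w] pos[of "- w"] by (simp add: SG_adj_iff)
  moreover have "- w \<in> {(1, 0), (0, 1)} \<longleftrightarrow> w \<in> {(-1, 0), (0, -1 :: int)}" for w :: vertex
    by (cases w) auto
  ultimately show ?thesis by auto
qed

section \<open>Translates of the graphs \<open>G\<^sub>n\<close> and their midpoints\<close>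

definition noncorners :: "nat \<Rightarrow> vertex set" where
  "noncorners n = G_verts n - {(0, 0), (2 ^ n, 0), (0, 2 ^ n)}"

lemma noncorners_0: "noncorners 0 = {}"
  by (simp add: noncorners_def)

text \<open>The inductions over non-corners rest on this decomposition: a non-corner of
  \<open>G\<^sub>n\<^sub>+\<^sub>1\<close> lies in the interior of one of the three pieces or is one of the three points where two pieces
  meet.\<close>
lemma noncorners_Suc_iff:
  "(x, y) \<in> noncorners (Suc n) \<longleftrightarrow>
     (x, y) \<in> noncorners n \<or> (x - 2 ^ n, y) \<in> noncorners n \<or> (x, y - 2 ^ n) \<in> noncorners n \<or>
     (x, y) \<in> {(2 ^ n, 0), (0, 2 ^ n), (2 ^ n, 2 ^ n)}"
proof
  assume "(x, y) \<in> noncorners (Suc n)"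
  then show "(x, y) \<in> noncorners n \<or> (x - 2 ^ n, y) \<in> noncorners n \<or> (x, y - 2 ^ n) \<in> noncorners n \<or>
     (x, y) \<in> {(2 ^ n, 0), (0, 2 ^ n), (2 ^ n, 2 ^ n)}"
    unfolding noncorners_def Diff_iff G_verts_Suc_iff by (auto simp: diff_eq_eq)
next
  assume *: "(x, y) \<in> noncorners n \<or> (x - 2 ^ n, y) \<in> noncorners n \<or> (x, y - 2 ^ n) \<in> noncorners n \<or>
     (x, y) \<in> {(2 ^ n, 0), (0, 2 ^ n), (2 ^ n, 2 ^ n)}"
  have pos: "(0 :: int) < 2 ^ n" by simp
  have "(x, y) \<in> G_verts (Suc n)"
    using * G_corners[of n] by (auto simp: noncorners_def G_verts_Suc_iff)
  moreover have "(x, y) \<noteq> (0, 0)" "(x, y) \<noteq> (2 ^ Suc n, 0)" "(x, y) \<noteq> (0, 2 ^ Suc n)"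
    using * pos by (auto simp: noncorners_def dest!: G_verts_bound)
  ultimately show "(x, y) \<in> noncorners (Suc n)" by (simp add: noncorners_def)
qed

text \<open>The translate of \<open>G\<^sub>n\<close> by \<open>(p, q)\<close> is a part of the gasket. Only cells are required here; vertices
  follow in \<open>placed_G_verts\<close>.\<close>
definition placed :: "nat \<Rightarrow> int \<Rightarrow> int \<Rightarrow> bool" where
  "placed n p q \<longleftrightarrow> (\<forall>a b. (a, b) \<in> cells n \<longrightarrow> (p + a, q + b) \<in> all_cells)"

lemma placed_zero: "placed n 0 0"
  by (auto simp: placed_def all_cells_def)

lemma placed_SucD:
  assumes "placed (Suc n) p q"
  shows "placed n p q" "placed n (p + 2 ^ n) q" "placed n p (q + 2 ^ n)"
proof -
  have *: "(p + a, q + b) \<in> all_cells"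
    if "(a, b) \<in> cells n \<or> (a - 2 ^ n, b) \<in> cells n \<or> (a, b - 2 ^ n) \<in> cells n" for a b
    using assms that unfolding placed_def cells_Suc_iff by blast
  show "placed n p q" using * by (simp add: placed_def)
  show "placed n (p + 2 ^ n) q" using *[of "2 ^ n + _"] by (simp add: placed_def add.assoc)
  show "placed n p (q + 2 ^ n)" using *[of _ "2 ^ n + _"] by (simp add: placed_def add.assoc)
qed

lemma placed_corner_cells:
  assumes "placed n p q"
  shows "(p, q) \<in> all_cells" "(p + 2 ^ n - 1, q) \<in> all_cells" "(p, q + 2 ^ n - 1) \<in> all_cells"
proof -
  have "(p + 0, q + 0) \<in> all_cells" "(p + (2 ^ n - 1), q + 0) \<in> all_cells"
    "(p + 0, q + (2 ^ n - 1)) \<in> all_cells"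
    using assms corner_cells[of n] unfolding placed_def by blast+
  then show "(p, q) \<in> all_cells" "(p + 2 ^ n - 1, q) \<in> all_cells" "(p, q + 2 ^ n - 1) \<in> all_cells"
    by (simp_all add: add_diff_eq)
qed

lemma placed_G_verts:
  assumes "placed n p q" "(x, y) \<in> G_verts n"
  shows "(p + x, q + y) \<in> SG_plus"
proof -
  obtain a b where "(a, b) \<in> cells n" "(x, y) \<in> cell (a, b)"
    using assms(2) by (auto simp: G_verts_eq_cells)
  then have "(p + a, q + b) \<in> all_cells" "(p + x, q + y) \<in> cell (p + a, q + b)"
    using assms(1) by (auto simp: placed_def cell_def)
  then show ?thesis by (auto simp: SG_plus_eq_cells)
qed

definition in_two_cells :: "int \<Rightarrow> int \<Rightarrow> bool" where
  "in_two_cells x y \<longleftrightarrow>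
     (x, y) \<in> all_cells \<and> (x - 1, y) \<in> all_cells \<or>
     (x, y) \<in> all_cells \<and> (x, y - 1) \<in> all_cells \<or>
     (x - 1, y) \<in> all_cells \<and> (x, y - 1) \<in> all_cells"

lemma noncorners_in_two_cells:
  assumes "placed n p q" "(x, y) \<in> noncorners n"
  shows "in_two_cells (p + x) (q + y)"
  using assms
proof (induction n arbitrary: p q x y)
  case 0
  then show ?case by (simp add: noncorners_0)
next
  case (Suc n)
  note pl = placed_SucD[OF Suc.prems(1)]
  note cs = pl[THEN placed_corner_cells(1)] pl[THEN placed_corner_cells(2)] pl[THEN placed_corner_cells(3)]
  from Suc.prems(2) consider "(x, y) \<in> noncorners n" | "(x - 2 ^ n, y) \<in> noncorners n"
    | "(x, y - 2 ^ n) \<in> noncorners n" | "(x, y) \<in> {(2 ^ n, 0), (0, 2 ^ n), (2 ^ n, 2 ^ n)}"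
    unfolding noncorners_Suc_iff by blast
  then show ?case
  proof cases
    case 1
    then show ?thesis using Suc.IH[OF pl(1)] by blast
  next
    case 2
    then show ?thesis using Suc.IH[OF pl(2) 2] by simp
  next
    case 3
    then show ?thesis using Suc.IH[OF pl(3) 3] by simp
  next
    case 4
    then show ?thesis using cs by (auto simp: in_two_cells_def)
  qed
qed

lemma SG_plus_eventually_noncorner:
  assumes "(x, y) \<in> SG_plus" "(x, y) \<noteq> (0, 0)"
  shows "\<exists>n. (x, y) \<in> noncorners n"
proof -
  define n where "n = nat (x + y)"
  have "int n < 2 ^ n" by simp
  moreover have "int n = x + y" using SG_plus_nonneg[OF assms(1)] by (simp add: n_def)
  ultimately have "x + y < 2 ^ n" by simp
  moreover from this have "(x, y) \<in> G_verts n" using SG_plus_bounded_in_G_verts assms(1) by simp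
  ultimately show ?thesis using assms(2) by (intro exI[of _ n]) (auto simp: noncorners_def)
qed

lemma SG_plus_in_two_cells:
  assumes "(x, y) \<in> SG_plus" "(x, y) \<noteq> (0, 0)"
  shows "in_two_cells x y"
  using SG_plus_eventually_noncorner[OF assms] noncorners_in_two_cells[OF placed_zero] by fastforce

text \<open>Four-regularity is what makes \<open>\<Delta>\<close> an average minus the value, as the maximum principle
  needs.\<close>
lemma card_nbrs: "card {y. x \<sim> y} = 4" if "x \<in> SG"
proof -
  have plus: "card {y. z \<sim> y} = 4" if "z \<in> SG_plus" for z
  proof (cases z)
    case (Pair a b)
    show ?thesis
    proof (cases "z = (0, 0)")
      case True
      then show ?thesis by (simp add: nbrs_zero)
    next
      case False
      then have "in_two_cells a b" using SG_plus_in_two_cells that Pair by blast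
      then show ?thesis
        unfolding in_two_cells_def Pair
        by (elim disjE conjE) (simp_all add: nbrs_bottom nbrs_left nbrs_right)
    qed
  qed
  from that consider "x \<in> SG_plus" | z where "z \<in> SG_plus" "x = - z"
    by (auto simp: SG_def)
  then show ?thesis
    by cases (simp_all add: plus nbrs_uminus card_image)
qed

lemma laplacian_bottom:
  assumes "(x, y) \<in> all_cells" "(x - 1, y) \<in> all_cells"
  shows "4 * laplacian f (x, y) =
    f (x + 1, y) + f (x, y + 1) + f (x - 1, y) + f (x - 1, y + 1) - 4 * f (x, y)"
  by (simp add: laplacian_def nbrs_bottom[OF assms])

lemma laplacian_left:
  assumes "(x, y) \<in> all_cells" "(x, y - 1) \<in> all_cells"
  shows "4 * laplacian f (x, y) =
    f (x + 1, y) + f (x, y + 1) + f (x, y - 1) + f (x + 1, y - 1) - 4 * f (x, y)"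
  by (simp add: laplacian_def nbrs_left[OF assms])

lemma laplacian_right:
  assumes "(x - 1, y) \<in> all_cells" "(x, y - 1) \<in> all_cells"
  shows "4 * laplacian f (x, y) =
    f (x - 1, y) + f (x - 1, y + 1) + f (x, y - 1) + f (x + 1, y - 1) - 4 * f (x, y)"
  by (simp add: laplacian_def nbrs_right[OF assms])

text \<open>Discrete normal derivatives at the corners of the translate of \<open>G\<^sub>n\<close> by \<open>(p, q)\<close>: only the two
  neighbours inside the translate are taken into account. At the lower left corner these do not depend on
  \<open>n\<close>.\<close>
definition flux_origin :: "(vertex \<Rightarrow> real) \<Rightarrow> int \<Rightarrow> int \<Rightarrow> real" where
  "flux_origin f p q = f (p + 1, q) + f (p, q + 1) - 2 * f (p, q)"

definition flux_right :: "(vertex \<Rightarrow> real) \<Rightarrow> nat \<Rightarrow> int \<Rightarrow> int \<Rightarrow> real" where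
  "flux_right f n p q = f (p + 2 ^ n - 1, q) + f (p + 2 ^ n - 1, q + 1) - 2 * f (p + 2 ^ n, q)"

definition flux_top :: "(vertex \<Rightarrow> real) \<Rightarrow> nat \<Rightarrow> int \<Rightarrow> int \<Rightarrow> real" where
  "flux_top f n p q = f (p, q + 2 ^ n - 1) + f (p + 1, q + 2 ^ n - 1) - 2 * f (p, q + 2 ^ n)"

lemma flux_right_Suc: "flux_right f (Suc n) p q = flux_right f n (p + 2 ^ n) q"
  by (simp add: flux_right_def add.assoc)

lemma flux_top_Suc: "flux_top f (Suc n) p q = flux_top f n p (q + 2 ^ n)"
  by (simp add: flux_top_def add.assoc)

text \<open>At a midpoint the neighbours split into two pairs, one in each of the pieces that
  meet there.\<close>
lemma laplacian_midpoints:
  assumes "placed (Suc n) p q"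
  shows "4 * laplacian f (p + 2 ^ n, q) = flux_right f n p q + flux_origin f (p + 2 ^ n) q"
    and "4 * laplacian f (p, q + 2 ^ n) = flux_top f n p q + flux_origin f p (q + 2 ^ n)"
    and "4 * laplacian f (p + 2 ^ n, q + 2 ^ n) =
           flux_top f n (p + 2 ^ n) q + flux_right f n p (q + 2 ^ n)"
proof -
  note pl = placed_SucD[OF assms]
  note cs = pl[THEN placed_corner_cells(1)] pl[THEN placed_corner_cells(2)] pl[THEN placed_corner_cells(3)]
  show "4 * laplacian f (p + 2 ^ n, q) = flux_right f n p q + flux_origin f (p + 2 ^ n) q"
    using laplacian_bottom[OF cs(2) cs(4)] by (simp add: flux_right_def flux_origin_def)
  show "4 * laplacian f (p, q + 2 ^ n) = flux_top f n p q + flux_origin f p (q + 2 ^ n)"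
    using laplacian_left[OF cs(3) cs(7)] by (simp add: flux_top_def flux_origin_def)
  show "4 * laplacian f (p + 2 ^ n, q + 2 ^ n) =
           flux_top f n (p + 2 ^ n) q + flux_right f n p (q + 2 ^ n)"
    using laplacian_right[OF cs(6) cs(8)] by (simp add: flux_top_def flux_right_def)
qed

section \<open>Decimation of the Poisson equation\<close>

text \<open>The equation \<open>\<Delta>f = 1\<close> at the non-corners of the translate of \<open>G\<^sub>n\<close> by \<open>(p, q)\<close>, in recursive form.
  It mentions values of \<open>f\<close> on the translate only, so it makes sense for any \<open>(p, q)\<close>; for a
  translate inside the gasket it agrees with the Laplacian of \<open>SG\<close> by \<open>poisson_iff_laplacian\<close>.\<close>
primrec poisson :: "(vertex \<Rightarrow> real) \<Rightarrow> nat \<Rightarrow> int \<Rightarrow> int \<Rightarrow> bool" where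
  "poisson f 0 p q \<longleftrightarrow> True"
| "poisson f (Suc n) p q \<longleftrightarrow>
     poisson f n p q \<and> poisson f n (p + 2 ^ n) q \<and> poisson f n p (q + 2 ^ n) \<and>
     flux_right f n p q + flux_origin f (p + 2 ^ n) q = 4 \<and>
     flux_top f n p q + flux_origin f p (q + 2 ^ n) = 4 \<and>
     flux_top f n (p + 2 ^ n) q + flux_right f n p (q + 2 ^ n) = 4"

lemma poisson_iff_laplacian:
  assumes "placed n p q"
  shows "poisson f n p q \<longleftrightarrow> (\<forall>x y. (x, y) \<in> noncorners n \<longrightarrow> laplacian f (p + x, q + y) = 1)"
  using assms
proof (induction n arbitrary: p q)
  case 0
  show ?case by (simp add: noncorners_0)
next
  case (Suc n)
  note pl = placed_SucD[OF Suc.prems]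
  have shift: "(\<forall>x y. (x - a, y - b) \<in> noncorners n \<longrightarrow> laplacian f (p + x, q + y) = 1) \<longleftrightarrow>
      (\<forall>x y. (x, y) \<in> noncorners n \<longrightarrow> laplacian f (p + a + x, q + b + y) = 1)" for a b
  proof (intro iffI allI impI)
    fix x y
    assume "\<forall>x y. (x - a, y - b) \<in> noncorners n \<longrightarrow> laplacian f (p + x, q + y) = 1" "(x, y) \<in> noncorners n"
    from this(1)[rule_format, of "a + x" "b + y"] this(2)
    show "laplacian f (p + a + x, q + b + y) = 1" by (simp add: add.assoc)
  next
    fix x y
    assume "\<forall>x y. (x, y) \<in> noncorners n \<longrightarrow> laplacian f (p + a + x, q + b + y) = 1" "(x - a, y - b) \<in> noncorners n"
    from this(1)[rule_format, OF this(2)] show "laplacian f (p + x, q + y) = 1" by simp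
  qed
  have "(\<forall>x y. (x, y) \<in> noncorners (Suc n) \<longrightarrow> laplacian f (p + x, q + y) = 1) \<longleftrightarrow>
      (\<forall>x y. (x, y) \<in> noncorners n \<longrightarrow> laplacian f (p + x, q + y) = 1) \<and>
      (\<forall>x y. (x - 2 ^ n, y - 0) \<in> noncorners n \<longrightarrow> laplacian f (p + x, q + y) = 1) \<and>
      (\<forall>x y. (x - 0, y - 2 ^ n) \<in> noncorners n \<longrightarrow> laplacian f (p + x, q + y) = 1) \<and>
      laplacian f (p + 2 ^ n, q + 0) = 1 \<and> laplacian f (p + 0, q + 2 ^ n) = 1 \<and>
      laplacian f (p + 2 ^ n, q + 2 ^ n) = 1"
    unfolding noncorners_Suc_iff diff_zero by blast
  then show ?case
    unfolding shift using Suc.IH[OF pl(1)] Suc.IH[OF pl(2)] Suc.IH[OF pl(3)]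
      laplacian_midpoints[OF Suc.prems, of f] by auto
qed

text \<open>The value at the midpoint between the corners with values \<open>a\<close> and \<open>b\<close> of a copy of
  \<open>G\<^sub>n\<^sub>+\<^sub>1\<close>: the harmonic \<open>2/5\<close>-\<open>2/5\<close>-\<open>1/5\<close> rule, corrected by a constant for the right-hand side \<open>1\<close>.\<close>
definition mid_value :: "nat \<Rightarrow> real \<Rightarrow> real \<Rightarrow> real \<Rightarrow> real" where
  "mid_value n a b c = (2 * a + 2 * b + c) / 5 - 2 * 5 ^ n"

text \<open>The three flux balances at the midpoints form a nonsingular linear system. Adding them up gives
  \<open>x + y + z\<close>, and then each equation contains a single unknown.\<close>
lemma mid_value_unique:
  fixes a b c x y z :: real
  assumes "a + b + y + z - 4 * x = 4 * 5 ^ n" "a + c + x + z - 4 * y = 4 * 5 ^ n"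
    "b + c + x + y - 4 * z = 4 * 5 ^ n"
  shows "x = mid_value n a b c" "y = mid_value n a c b" "z = mid_value n b c a"
proof -
  have sum: "x + y + z = a + b + c - 6 * 5 ^ n" using assms by simp
  have "5 * x = 2 * a + 2 * b + c - 10 * 5 ^ n" "5 * y = 2 * a + 2 * c + b - 10 * 5 ^ n"
    "5 * z = 2 * b + 2 * c + a - 10 * 5 ^ n"
    using assms sum by simp_all
  then show "x = mid_value n a b c" "y = mid_value n a c b" "z = mid_value n b c a"
    by (simp_all add: mid_value_def field_simps)
qed

text \<open>Since \<open>3\<^sup>n = (3/5)\<^sup>n 5\<^sup>n\<close>, the scale factor \<open>(3/5)\<^sup>n\<close> cancels from a flux balance.\<close>
lemma flux_sum_eq_4_iff:
  fixes s t :: real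
  shows "((3 / 5) ^ n * s - 2 * (3 ^ n - 1)) + ((3 / 5) ^ n * t - 2 * (3 ^ n - 1)) = 4
     \<longleftrightarrow> s + t = 4 * 5 ^ n"
proof -
  have "(3 :: real) ^ n = (3 / 5) ^ n * 5 ^ n" by (simp flip: power_mult_distrib)
  then have "((3 / 5) ^ n * s - 2 * (3 ^ n - 1)) + ((3 / 5) ^ n * t - 2 * (3 ^ n - 1)) - 4
      = (3 / 5) ^ n * (s + t - 4 * 5 ^ n)"
    by (simp add: algebra_simps)
  moreover have "(3 / 5 :: real) ^ n \<noteq> 0" by simp
  ultimately show ?thesis by (metis eq_iff_diff_eq_0 mult_eq_0_iff)
qed

text \<open>With the midpoint values inserted, the flux at a corner, expressed by the corner values of the
  adjacent piece, takes the form of the flux law one level higher.\<close>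
lemma flux_step:
  fixes a b c x y :: real
  assumes "x = mid_value n a b c" "y = mid_value n a c b"
  shows "(3 / 5) ^ n * (x + y - 2 * a) - 2 * (3 ^ n - 1) =
    (3 / 5) ^ Suc n * (b + c - 2 * a) - 2 * (3 ^ Suc n - 1)"
proof -
  have T: "(3 :: real) ^ n = (3 / 5) ^ n * 5 ^ n" by (simp flip: power_mult_distrib)
  have *: "(3 / 5) ^ n * (3 / 5 * s - 4 * 5 ^ n) = (3 / 5) ^ Suc n * s - 4 * 3 ^ n" for s :: real
    by (simp add: T algebra_simps)
  have "x + y - 2 * a = 3 / 5 * (b + c - 2 * a) - 4 * 5 ^ n"
    unfolding assms mid_value_def by (simp add: field_simps)
  then show ?thesis using *[of "b + c - 2 * a"] by simp
qed

lemma mid_value_commute: "mid_value n a b c = mid_value n b a c"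
  by (simp add: mid_value_def)

text \<open>The factor \<open>(3/5)\<^sup>n\<close> is the effective conductance scaling of the gasket. The constant accounts for
  the sources: the fluxes at all corners sum up to minus \<open>4\<close> times the number
  \<open>3(3\<^sup>n - 1)/2\<close> of non-corners, and each corner carries a third of this.\<close>
definition flux_law :: "(vertex \<Rightarrow> real) \<Rightarrow> nat \<Rightarrow> int \<Rightarrow> int \<Rightarrow> bool" where
  "flux_law f n p q \<longleftrightarrow>
     flux_origin f p q =
       (3 / 5) ^ n * (f (p + 2 ^ n, q) + f (p, q + 2 ^ n) - 2 * f (p, q)) - 2 * (3 ^ n - 1) \<and>
     flux_right f n p q =
       (3 / 5) ^ n * (f (p, q) + f (p, q + 2 ^ n) - 2 * f (p + 2 ^ n, q)) - 2 * (3 ^ n - 1) \<and>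
     flux_top f n p q =
       (3 / 5) ^ n * (f (p, q) + f (p + 2 ^ n, q) - 2 * f (p, q + 2 ^ n)) - 2 * (3 ^ n - 1)"

lemma flux_lawD:
  assumes "flux_law f n p q"
  shows "flux_origin f p q =
       (3 / 5) ^ n * (f (p + 2 ^ n, q) + f (p, q + 2 ^ n) - 2 * f (p, q)) - 2 * (3 ^ n - 1)"
    and "flux_right f n p q =
       (3 / 5) ^ n * (f (p, q) + f (p, q + 2 ^ n) - 2 * f (p + 2 ^ n, q)) - 2 * (3 ^ n - 1)"
    and "flux_top f n p q =
       (3 / 5) ^ n * (f (p, q) + f (p + 2 ^ n, q) - 2 * f (p, q + 2 ^ n)) - 2 * (3 ^ n - 1)"
  using assms by (simp_all add: flux_law_def)

lemma midpoints_of_flux_laws: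
  assumes P: "poisson f (Suc n) p q"
    and laws: "flux_law f n p q" "flux_law f n (p + 2 ^ n) q" "flux_law f n p (q + 2 ^ n)"
  shows "f (p + 2 ^ n, q) = mid_value n (f (p, q)) (f (p + 2 ^ Suc n, q)) (f (p, q + 2 ^ Suc n))"
    and "f (p, q + 2 ^ n) = mid_value n (f (p, q)) (f (p, q + 2 ^ Suc n)) (f (p + 2 ^ Suc n, q))"
    and "f (p + 2 ^ n, q + 2 ^ n) =
           mid_value n (f (p + 2 ^ Suc n, q)) (f (p, q + 2 ^ Suc n)) (f (p, q))"
proof -
  have d: "p + 2 ^ n + 2 ^ n = p + 2 ^ Suc n" "q + 2 ^ n + 2 ^ n = q + 2 ^ Suc n" by simp_all
  have glue: "flux_right f n p q + flux_origin f (p + 2 ^ n) q = 4"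
    "flux_top f n p q + flux_origin f p (q + 2 ^ n) = 4"
    "flux_top f n (p + 2 ^ n) q + flux_right f n p (q + 2 ^ n) = 4"
    using P by simp_all
  note eqs = glue[unfolded flux_lawD[OF laws(1)] flux_lawD[OF laws(2)] flux_lawD[OF laws(3)]
      flux_sum_eq_4_iff d]
  have bal: "f (p, q) + f (p + 2 ^ Suc n, q) + f (p, q + 2 ^ n) + f (p + 2 ^ n, q + 2 ^ n)
        - 4 * f (p + 2 ^ n, q) = 4 * 5 ^ n"
    "f (p, q) + f (p, q + 2 ^ Suc n) + f (p + 2 ^ n, q) + f (p + 2 ^ n, q + 2 ^ n)
        - 4 * f (p, q + 2 ^ n) = 4 * 5 ^ n"
    "f (p + 2 ^ Suc n, q) + f (p, q + 2 ^ Suc n) + f (p + 2 ^ n, q) + f (p, q + 2 ^ n)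
        - 4 * f (p + 2 ^ n, q + 2 ^ n) = 4 * 5 ^ n"
    using eqs by linarith+
  from mid_value_unique[OF bal]
  show "f (p + 2 ^ n, q) = mid_value n (f (p, q)) (f (p + 2 ^ Suc n, q)) (f (p, q + 2 ^ Suc n))"
    and "f (p, q + 2 ^ n) = mid_value n (f (p, q)) (f (p, q + 2 ^ Suc n)) (f (p + 2 ^ Suc n, q))"
    and "f (p + 2 ^ n, q + 2 ^ n) =
           mid_value n (f (p + 2 ^ Suc n, q)) (f (p, q + 2 ^ Suc n)) (f (p, q))" .
qed

text \<open>In the induction step the flux laws of the three pieces determine the midpoints, and each corner of
  the large triangle is a corner of one piece, whose other two corners are midpoints.\<close>
lemma poisson_imp_flux_law: "poisson f n p q \<Longrightarrow> flux_law f n p q"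
proof (induction n arbitrary: p q)
  case 0
  show ?case by (simp add: flux_law_def flux_origin_def flux_right_def flux_top_def)
next
  case (Suc n)
  have laws: "flux_law f n p q" "flux_law f n (p + 2 ^ n) q" "flux_law f n p (q + 2 ^ n)"
    using Suc by simp_all
  note m = midpoints_of_flux_laws[OF Suc.prems laws]
  have d: "p + 2 ^ n + 2 ^ n = p + 2 ^ Suc n" "q + 2 ^ n + 2 ^ n = q + 2 ^ Suc n" by simp_all
  have "flux_origin f p q =
      (3 / 5) ^ Suc n * (f (p + 2 ^ Suc n, q) + f (p, q + 2 ^ Suc n) - 2 * f (p, q))
        - 2 * (3 ^ Suc n - 1)"
    unfolding flux_lawD(1)[OF laws(1)] by (rule flux_step[OF m(1,2)])
  moreover have "flux_right f (Suc n) p q =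
      (3 / 5) ^ Suc n * (f (p, q) + f (p, q + 2 ^ Suc n) - 2 * f (p + 2 ^ Suc n, q))
        - 2 * (3 ^ Suc n - 1)"
    unfolding flux_right_Suc flux_lawD(2)[OF laws(2)] d
    by (rule flux_step[OF m(1)[unfolded mid_value_commute[of n "f (p, q)"]] m(3)])
  moreover have "flux_top f (Suc n) p q =
      (3 / 5) ^ Suc n * (f (p, q) + f (p + 2 ^ Suc n, q) - 2 * f (p, q + 2 ^ Suc n))
        - 2 * (3 ^ Suc n - 1)"
    unfolding flux_top_Suc flux_lawD(3)[OF laws(3)] d
    by (rule flux_step[OF m(2)[unfolded mid_value_commute[of n "f (p, q)"]]
          m(3)[unfolded mid_value_commute[of n "f (p + 2 ^ Suc n, q)"]]])
  ultimately show ?case by (simp only: flux_law_def)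
qed

lemmas poisson_flux = poisson_imp_flux_law[THEN flux_lawD(1)]
  poisson_imp_flux_law[THEN flux_lawD(2)] poisson_imp_flux_law[THEN flux_lawD(3)]

lemma poisson_midpoints:
  assumes "poisson f (Suc n) p q"
  shows "f (p + 2 ^ n, q) = mid_value n (f (p, q)) (f (p + 2 ^ Suc n, q)) (f (p, q + 2 ^ Suc n))"
    and "f (p, q + 2 ^ n) = mid_value n (f (p, q)) (f (p, q + 2 ^ Suc n)) (f (p + 2 ^ Suc n, q))"
    and "f (p + 2 ^ n, q + 2 ^ n) =
           mid_value n (f (p + 2 ^ Suc n, q)) (f (p, q + 2 ^ Suc n)) (f (p, q))"
  by (rule midpoints_of_flux_laws[OF assms]; rule poisson_imp_flux_law; use assms in simp)+

section \<open>The solution with given corner values\<close>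

text \<open>The solution on \<open>G\<^sub>n\<close> with the values \<open>a\<close>, \<open>b\<close>, \<open>c\<close> at \<open>(0, 0)\<close>, \<open>(2\<^sup>n, 0)\<close>, \<open>(0, 2\<^sup>n)\<close>. The
  case distinction assigns a common point of two pieces to one of them; by
  \<open>dirichlet_corners\<close> the other piece would give the same value.\<close>
primrec dirichlet :: "nat \<Rightarrow> real \<Rightarrow> real \<Rightarrow> real \<Rightarrow> vertex \<Rightarrow> real" where
  "dirichlet 0 a b c = (\<lambda>(x, y). if x = 1 then b else if y = 1 then c else a)"
| "dirichlet (Suc n) a b c = (\<lambda>(x, y).
     if x + y \<le> 2 ^ n then dirichlet n a (mid_value n a b c) (mid_value n a c b) (x, y)
     else if 2 ^ n \<le> x then dirichlet n (mid_value n a b c) b (mid_value n b c a) (x - 2 ^ n, y)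
     else dirichlet n (mid_value n a c b) (mid_value n b c a) c (x, y - 2 ^ n))"

lemma dirichlet_corners:
  "dirichlet n a b c (0, 0) = a" "dirichlet n a b c (2 ^ n, 0) = b" "dirichlet n a b c (0, 2 ^ n) = c"
proof -
  have "dirichlet n a b c (0, 0) = a \<and> dirichlet n a b c (2 ^ n, 0) = b \<and> dirichlet n a b c (0, 2 ^ n) = c"
    by (induction n arbitrary: a b c) simp_all
  then show "dirichlet n a b c (0, 0) = a" "dirichlet n a b c (2 ^ n, 0) = b" "dirichlet n a b c (0, 2 ^ n) = c"
    by simp_all
qed

lemma dirichlet_Suc_pieces:
  assumes "(x, y) \<in> G_verts n"
  shows "dirichlet (Suc n) a b c (x, y) = dirichlet n a (mid_value n a b c) (mid_value n a c b) (x, y)"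
    and "dirichlet (Suc n) a b c (2 ^ n + x, y) = dirichlet n (mid_value n a b c) b (mid_value n b c a) (x, y)"
    and "dirichlet (Suc n) a b c (x, 2 ^ n + y) = dirichlet n (mid_value n a c b) (mid_value n b c a) c (x, y)"
proof -
  note bd = G_verts_bound[OF assms]
  show "dirichlet (Suc n) a b c (x, y) = dirichlet n a (mid_value n a b c) (mid_value n a c b) (x, y)"
    using bd by simp
  show "dirichlet (Suc n) a b c (2 ^ n + x, y) = dirichlet n (mid_value n a b c) b (mid_value n b c a) (x, y)"
  proof (cases "x + y \<le> 0")
    case True
    then have "x = 0" "y = 0" using bd by auto
    then show ?thesis by (simp add: dirichlet_corners)
  qed (use bd in simp)
  show "dirichlet (Suc n) a b c (x, 2 ^ n + y) = dirichlet n (mid_value n a c b) (mid_value n b c a) c (x, y)"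
  proof -
    consider "x + y \<le> 0" | "2 ^ n \<le> x" | "\<not> x + y \<le> 0" "\<not> 2 ^ n \<le> x" by blast
    then show ?thesis
    proof cases
      case 1
      then have "x = 0" "y = 0" using bd by auto
      then show ?thesis by (simp add: dirichlet_corners)
    next
      case 2
      then have "x = 2 ^ n" "y = 0" using bd by auto
      then show ?thesis by (simp add: dirichlet_corners)
    qed simp
  qed
qed

text \<open>Uniqueness for the Dirichlet problem: the corner values force those at the midpoints,
  and so on down to single cells.\<close>
lemma poisson_imp_dirichlet:
  assumes "poisson f n p q" "(x, y) \<in> G_verts n"
  shows "f (p + x, q + y) = dirichlet n (f (p, q)) (f (p + 2 ^ n, q)) (f (p, q + 2 ^ n)) (x, y)"
  using assms
proof (induction n arbitrary: p q x y)
  case 0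
  then show ?case by auto
next
  case (Suc n)
  have sub: "poisson f n p q" "poisson f n (p + 2 ^ n) q" "poisson f n p (q + 2 ^ n)"
    using Suc.prems by simp_all
  have d: "p + 2 ^ n + 2 ^ n = p + 2 ^ Suc n" "q + 2 ^ n + 2 ^ n = q + 2 ^ Suc n" by simp_all
  note mids = poisson_midpoints[OF Suc.prems(1)]
  note pieces = dirichlet_Suc_pieces[of _ _ n "f (p, q)" "f (p + 2 ^ Suc n, q)" "f (p, q + 2 ^ Suc n)"]
  from Suc.prems(2) consider "(x, y) \<in> G_verts n" | "(x - 2 ^ n, y) \<in> G_verts n"
    | "(x, y - 2 ^ n) \<in> G_verts n"
    unfolding G_verts_Suc_iff by blast
  then show ?case
  proof cases
    case 1
    show ?thesis
      unfolding pieces(1)[OF 1] mids[symmetric] by (rule Suc.IH[OF sub(1) 1])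
  next
    case 2
    show ?thesis
      using pieces(2)[OF 2] Suc.IH[OF sub(2) 2] unfolding mids[symmetric] d by (simp del: dirichlet.simps)
  next
    case 3
    show ?thesis
      using pieces(3)[OF 3] Suc.IH[OF sub(3) 3] unfolding mids[symmetric] d by (simp del: dirichlet.simps)
  qed
qed

text \<open>Existence for the Dirichlet problem: each piece satisfies the flux law, and the midpoint values
  were chosen to balance the fluxes.\<close>
lemma dirichlet_imp_poisson:
  assumes "\<And>x y. (x, y) \<in> G_verts n \<Longrightarrow> f (p + x, q + y) = dirichlet n a b c (x, y)"
  shows "poisson f n p q"
  using assms
proof (induction n arbitrary: p q a b c)
  case 0
  show ?case by simp
next
  case (Suc n)
  have P1: "f (p + x, q + y) = dirichlet n a (mid_value n a b c) (mid_value n a c b) (x, y)"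
    and P2: "f (p + 2 ^ n + x, q + y) = dirichlet n (mid_value n a b c) b (mid_value n b c a) (x, y)"
    and P3: "f (p + x, q + 2 ^ n + y) = dirichlet n (mid_value n a c b) (mid_value n b c a) c (x, y)"
    if "(x, y) \<in> G_verts n" for x y
    using that dirichlet_Suc_pieces[OF that, of a b c] Suc.prems[of x y] Suc.prems[of "2 ^ n + x" y]
      Suc.prems[of x "2 ^ n + y"] by (simp_all add: G_verts_Suc_iff add.assoc)
  have sub: "poisson f n p q" "poisson f n (p + 2 ^ n) q" "poisson f n p (q + 2 ^ n)"
    using Suc.IH[OF P1] Suc.IH[OF P2] Suc.IH[OF P3] by blast+
  have cs: "(0, 0) \<in> G_verts n" "(2 ^ n, 0) \<in> G_verts n" "(0, 2 ^ n) \<in> G_verts n"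
    using G_corners zero_in_G_verts by blast+
  have vals: "f (p, q) = a" "f (p + 2 ^ n, q) = mid_value n a b c" "f (p, q + 2 ^ n) = mid_value n a c b"
    "f (p + 2 ^ n + 2 ^ n, q) = b" "f (p + 2 ^ n, q + 2 ^ n) = mid_value n b c a" "f (p, q + 2 ^ n + 2 ^ n) = c"
    using P1[OF cs(1)] P1[OF cs(2)] P1[OF cs(3)] P2[OF cs(2)] P2[OF cs(3)] P3[OF cs(3)]
    by (simp_all add: dirichlet_corners)
  note fl = poisson_flux[OF sub(1)] poisson_flux[OF sub(2)] poisson_flux[OF sub(3)]
  show ?case
    unfolding poisson.simps fl flux_sum_eq_4_iff vals using sub by (simp add: mid_value_def field_simps)
qed

text \<open>The map \<open>(x, y) \<mapsto> (y, 2\<^sup>n - x - y)\<close> is the rotation of \<open>G\<^sub>n\<close> that takes the origin to the top, the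
  top to the right corner and the right corner to the origin; the midpoint rule has no preferred
  corner.\<close>
lemma dirichlet_rotate:
  assumes "(x, y) \<in> G_verts n"
  shows "(y, 2 ^ n - x - y) \<in> G_verts n"
    and "dirichlet n a b c (y, 2 ^ n - x - y) = dirichlet n c a b (x, y)"
proof -
  have "(y, 2 ^ n - x - y) \<in> G_verts n \<and>
      (\<forall>a b c. dirichlet n a b c (y, 2 ^ n - x - y) = dirichlet n c a b (x, y))"
    using assms
  proof (induction n arbitrary: x y)
    case 0
    then show ?case by auto
  next
    case (Suc n)
    have pieces: "(y, 2 ^ n + (2 ^ n - x - y)) \<in> G_verts (Suc n)"
      "(y, 2 ^ n - x - y) \<in> G_verts (Suc n)" "(2 ^ n + y, 2 ^ n - x - y) \<in> G_verts (Suc n)"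
      "dirichlet (Suc n) a b c (y, 2 ^ n + (2 ^ n - x - y)) = dirichlet (Suc n) c a b (x, y)"
      "dirichlet (Suc n) a b c (y, 2 ^ n - x - y) = dirichlet (Suc n) c a b (2 ^ n + x, y)"
      "dirichlet (Suc n) a b c (2 ^ n + y, 2 ^ n - x - y) = dirichlet (Suc n) c a b (x, 2 ^ n + y)"
      if xy: "(x, y) \<in> G_verts n" for x y a b c
    proof -
      have r: "(y, 2 ^ n - x - y) \<in> G_verts n"
        "\<And>a b c. dirichlet n a b c (y, 2 ^ n - x - y) = dirichlet n c a b (x, y)"
        using Suc.IH[OF xy] by blast+
      show "(y, 2 ^ n + (2 ^ n - x - y)) \<in> G_verts (Suc n)"
        "(y, 2 ^ n - x - y) \<in> G_verts (Suc n)" "(2 ^ n + y, 2 ^ n - x - y) \<in> G_verts (Suc n)"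
        using r(1) unfolding G_verts_Suc_iff add_diff_cancel_left' by blast+
      show "dirichlet (Suc n) a b c (y, 2 ^ n + (2 ^ n - x - y)) = dirichlet (Suc n) c a b (x, y)"
        "dirichlet (Suc n) a b c (y, 2 ^ n - x - y) = dirichlet (Suc n) c a b (2 ^ n + x, y)"
        "dirichlet (Suc n) a b c (2 ^ n + y, 2 ^ n - x - y) = dirichlet (Suc n) c a b (x, 2 ^ n + y)"
        unfolding dirichlet_Suc_pieces[OF r(1)] dirichlet_Suc_pieces[OF xy] r(2) by (simp_all add: mid_value_commute)
    qed
    from Suc.prems consider "(x, y) \<in> G_verts n" | "(x - 2 ^ n, y) \<in> G_verts n" | "(x, y - 2 ^ n) \<in> G_verts n"
      unfolding G_verts_Suc_iff by blast
    then show ?case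
    proof cases
      case 1
      have eq: "2 ^ n + (2 ^ n - x - y) = 2 ^ Suc n - x - y" by simp
      show ?thesis using pieces(1,4)[OF 1, unfolded eq] by blast
    next
      case 2
      have eq: "2 ^ n - (x - 2 ^ n) - y = 2 ^ Suc n - x - y" "2 ^ n + (x - 2 ^ n) = x" by simp_all
      show ?thesis using pieces(2,5)[OF 2, unfolded eq] by blast
    next
      case 3
      have eq: "2 ^ n - x - (y - 2 ^ n) = 2 ^ Suc n - x - y" "2 ^ n + (y - 2 ^ n) = y" by simp_all
      show ?thesis using pieces(3,6)[OF 3, unfolded eq] by blast
    qed
  qed
  then show "(y, 2 ^ n - x - y) \<in> G_verts n"
    and "dirichlet n a b c (y, 2 ^ n - x - y) = dirichlet n c a b (x, y)" by blast+
qed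

section \<open>The function \<open>\<tilde>u\<close>\<close>

text \<open>The height \<open>2\<cdot>5\<^sup>n\<close> of the apex is the one that makes the normalised solutions on different
  levels agree.\<close>
definition tent :: "nat \<Rightarrow> vertex \<Rightarrow> real" where
  "tent n = dirichlet n 0 0 (2 * 5 ^ n)"

lemma mid_value_tent: "mid_value n 0 0 (2 * 5 ^ Suc n) = 0" "mid_value n 0 (2 * 5 ^ Suc n) 0 = 2 * 5 ^ n"
  by (simp_all add: mid_value_def)

lemma tent_Suc_pieces:
  assumes "(x, y) \<in> G_verts n"
  shows "tent (Suc n) (x, y) = tent n (x, y)"
    and "tent (Suc n) (2 ^ n + x, y) = tent n (x, y)"
    and "tent (Suc n) (x, 2 ^ n + y) = dirichlet n (2 * 5 ^ n) (2 * 5 ^ n) (2 * 5 ^ Suc n) (x, y)"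
  unfolding tent_def dirichlet_Suc_pieces[OF assms] mid_value_tent by (rule refl)+

lemma tent_corners: "tent n (0, 0) = 0" "tent n (2 ^ n, 0) = 0" "tent n (0, 2 ^ n) = 2 * 5 ^ n"
  by (simp_all add: tent_def dirichlet_corners)

lemma tent_bottom: "(x, 0) \<in> G_verts n \<Longrightarrow> tent n (x, 0) = 0"
proof (induction n arbitrary: x)
  case 0
  then show ?case by (auto simp: tent_def)
next
  case (Suc n)
  have "(x, 0 - 2 ^ n) \<notin> G_verts n" using G_verts_bound[of x "0 - 2 ^ n" n] by auto
  then consider "(x, 0) \<in> G_verts n" | "(x - 2 ^ n, 0) \<in> G_verts n"
    using Suc.prems unfolding G_verts_Suc_iff by blast
  then show ?case
  proof cases
    case 1
    then show ?thesis using tent_Suc_pieces(1) Suc.IH by simp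
  next
    case 2
    then show ?thesis using tent_Suc_pieces(2)[OF 2] Suc.IH by simp
  qed
qed

lemma tent_row_1: "(x, 1) \<in> G_verts n \<Longrightarrow> tent n (x, 1) = 2"
proof (induction n arbitrary: x)
  case 0
  then show ?case by (auto simp: tent_def)
next
  case (Suc n)
  from Suc.prems consider "(x, 1) \<in> G_verts n" | "(x - 2 ^ n, 1) \<in> G_verts n" | "(x, 1 - 2 ^ n) \<in> G_verts n"
    unfolding G_verts_Suc_iff by blast
  then show ?case
  proof cases
    case 1
    then show ?thesis using tent_Suc_pieces(1) Suc.IH by simp
  next
    case 2
    then show ?thesis using tent_Suc_pieces(2)[OF 2] Suc.IH by simp
  next
    case 3
    then have "(2 :: int) ^ n \<le> 1" using G_verts_bound by fastforce
    \<comment> \<open>Row \<open>1\<close> reaches the upper piece only if the lower pieces are single cells.\<close>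
    then have n: "n = 0" using one_less_power[of "2 :: int" n] by (cases "n = 0") linarith+
    then show ?thesis using Suc.prems 3 tent_Suc_pieces(3)[of x 0 n] by (auto simp: tent_def)
  qed
qed

text \<open>The bound \<open>2\<cdot>5\<^sup>n\<close> on the corner values passes to the pieces because the midpoint rule maps values
  of at least \<open>10\<cdot>5\<^sup>n\<close> to at least \<open>10\<cdot>5\<^sup>n - 2\<cdot>5\<^sup>n\<close>, which exceeds the bound \<open>2\<cdot>5\<^sup>n\<close> of the
  next lower level. It is needed for the upper piece of a tent.\<close>
lemma dirichlet_ge_2:
  assumes "2 * 5 ^ n \<le> a" "2 * 5 ^ n \<le> b" "2 * 5 ^ n \<le> c" "(x, y) \<in> G_verts n"
  shows "2 \<le> dirichlet n a b c (x, y)"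
  using assms
proof (induction n arbitrary: a b c x y)
  case 0
  then show ?case by auto
next
  case (Suc n)
  have mid: "2 * 5 ^ n \<le> mid_value n r s t"
    if "2 * 5 ^ Suc n \<le> r" "2 * 5 ^ Suc n \<le> s" "2 * 5 ^ Suc n \<le> t" for r s t
  proof -
    have "2 * w \<le> (2 * r + 2 * s + t) / 5 - 2 * w"
      if "0 < w" "2 * (5 * w) \<le> r" "2 * (5 * w) \<le> s" "2 * (5 * w) \<le> t" for w :: real
      using that by (simp add: field_simps)
    from this[of "5 ^ n"] show ?thesis using that by (simp add: mid_value_def)
  qed
  have le: "2 * 5 ^ n \<le> a" "2 * 5 ^ n \<le> b" "2 * 5 ^ n \<le> c"
  proof -
    have "(2 :: real) * 5 ^ n \<le> 2 * 5 ^ Suc n" by simp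
    from order_trans[OF this] show "2 * 5 ^ n \<le> a" "2 * 5 ^ n \<le> b" "2 * 5 ^ n \<le> c"
      using Suc.prems(1-3) by blast+
  qed
  note m = mid[OF Suc.prems(1,2,3)] mid[OF Suc.prems(1,3,2)] mid[OF Suc.prems(2,3,1)]
  from Suc.prems(4) consider "(x, y) \<in> G_verts n" | "(x - 2 ^ n, y) \<in> G_verts n" | "(x, y - 2 ^ n) \<in> G_verts n"
    unfolding G_verts_Suc_iff by blast
  then show ?case
  proof cases
    case 1
    show ?thesis unfolding dirichlet_Suc_pieces(1)[OF 1] using Suc.IH[OF _ _ _ 1] le m by blast
  next
    case 2
    have "2 \<le> dirichlet (Suc n) a b c (2 ^ n + (x - 2 ^ n), y)"
      unfolding dirichlet_Suc_pieces(2)[OF 2] using Suc.IH[OF _ _ _ 2] le m by blast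
    then show ?thesis by (simp del: dirichlet.simps)
  next
    case 3
    have "2 \<le> dirichlet (Suc n) a b c (x, 2 ^ n + (y - 2 ^ n))"
      unfolding dirichlet_Suc_pieces(3)[OF 3] using Suc.IH[OF _ _ _ 3] le m by blast
    then show ?thesis by (simp del: dirichlet.simps)
  qed
qed

lemma tent_pos: "(x, y) \<in> G_verts n \<Longrightarrow> 1 \<le> y \<Longrightarrow> 0 < tent n (x, y)"
proof (induction n arbitrary: x y)
  case 0
  then show ?case by (auto simp: tent_def)
next
  case (Suc n)
  from Suc.prems(1) consider "(x, y) \<in> G_verts n" | "(x - 2 ^ n, y) \<in> G_verts n" | "(x, y - 2 ^ n) \<in> G_verts n"
    unfolding G_verts_Suc_iff by blast
  then show ?case
  proof cases
    case 1
    then show ?thesis using tent_Suc_pieces(1) Suc by simp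
  next
    case 2
    then show ?thesis using tent_Suc_pieces(2)[OF 2] Suc by simp
  next
    case 3
    have "2 \<le> dirichlet n (2 * 5 ^ n) (2 * 5 ^ n) (2 * 5 ^ Suc n) (x, y - 2 ^ n)"
      by (rule dirichlet_ge_2[OF _ _ _ 3]) simp_all
    then show ?thesis using tent_Suc_pieces(3)[OF 3] by simp
  qed
qed

lemma tent_consistent:
  assumes "(x, y) \<in> G_verts m" "m \<le> n"
  shows "tent n (x, y) = tent m (x, y)"
  using assms(2)
proof (induction n rule: dec_induct)
  case (step n)
  then have "(x, y) \<in> G_verts n" using assms(1) G_verts_mono by blast
  then show ?case using step.IH tent_Suc_pieces(1) by simp
qed simp

text \<open>Any level that contains the vertex would do, by \<open>tent_consistent\<close>.\<close>
definition infinite_tent :: "vertex \<Rightarrow> real" where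
  "infinite_tent = (\<lambda>z\<in>SG_plus. tent (LEAST n. z \<in> G_verts n) z)"

lemma infinite_tent_eq_tent:
  assumes "(x, y) \<in> G_verts n"
  shows "infinite_tent (x, y) = tent n (x, y)"
proof -
  define m where "m = (LEAST n. (x, y) \<in> G_verts n)"
  have "(x, y) \<in> G_verts m" "m \<le> n" unfolding m_def using assms by (rule LeastI Least_le)+
  then have "tent n (x, y) = tent m (x, y)" by (rule tent_consistent)
  moreover have "(x, y) \<in> SG_plus" using assms by (auto simp: SG_plus_def)
  ultimately show ?thesis by (simp add: infinite_tent_def m_def)
qed

text \<open>Two rows determine the solution. The statement covers all translates along the
  bottom line because the induction step uses both lower pieces: they fix
  the two lower corners of the upper piece, and the left one fixes the flux into it. By the flux
  law this flux determines the value at the apex, and the upper piece is then a Dirichlet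
  problem.\<close>
lemma tent_unique:
  assumes zero: "\<And>x. 0 \<le> x \<Longrightarrow> f (x, 0) = 0"
    and two: "\<And>x. 0 \<le> x \<Longrightarrow> (x, 1) \<in> SG_plus \<Longrightarrow> f (x, 1) = 2"
    and lap: "\<And>x y. (x, y) \<in> SG_plus \<Longrightarrow> 1 \<le> y \<Longrightarrow> laplacian f (x, y) = 1"
    and "placed n p 0" "(x, y) \<in> G_verts n"
  shows "f (p + x, y) = tent n (x, y)"
  using assms(4,5)
proof (induction n arbitrary: p x y)
  case 0
  have "0 \<le> p" using placed_corner_cells(1)[OF 0(1)] all_cells_nonneg by blast
  moreover have "(p + 0, 0 + 1) \<in> SG_plus" by (rule placed_G_verts[OF 0(1)]) simp
  ultimately show ?case using 0(2) zero[of p] zero[of "p + 1"] two[of p] by (auto simp: tent_def)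
next
  case (Suc n)
  note pl = placed_SucD[OF Suc.prems(1), unfolded add_0]
  note left = Suc.IH[OF pl(1)] and right = Suc.IH[OF pl(2)]
  have pos: "(1 :: int) \<le> 2 ^ n" by simp
  have cs: "(0, 0) \<in> G_verts n" "(2 ^ n, 0) \<in> G_verts n" "(0, 2 ^ n) \<in> G_verts n"
    using G_corners zero_in_G_verts by blast+
  have d: "(2 :: int) ^ n + 2 ^ n = 2 ^ Suc n" by simp
  have P_left: "poisson f n p 0"
    by (rule dirichlet_imp_poisson[of _ _ _ _ 0 0 "2 * 5 ^ n"]) (simp add: left flip: tent_def)
  have P_top: "poisson f n p (2 ^ n)"
    unfolding poisson_iff_laplacian[OF pl(3)]
  proof (intro allI impI)
    fix x y
    assume "(x, y) \<in> noncorners n"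
    then have xy: "(x, y) \<in> G_verts n" by (simp add: noncorners_def)
    show "laplacian f (p + x, 2 ^ n + y) = 1"
    proof (rule lap)
      show "(p + x, 2 ^ n + y) \<in> SG_plus" by (rule placed_G_verts[OF pl(3) xy])
      show "1 \<le> 2 ^ n + y" using G_verts_bound[OF xy] pos by linarith
    qed
  qed
  have vals: "f (p, 0) = 0" "f (p + 2 ^ n, 0) = 0" "f (p, 2 ^ n) = 2 * 5 ^ n"
    "f (p + 2 ^ n, 2 ^ n) = 2 * 5 ^ n"
    using left[OF cs(1)] left[OF cs(2)] left[OF cs(3)] right[OF cs(3)] by (simp_all add: tent_corners)
  have "laplacian f (p, 2 ^ n) = 1"
  proof (rule lap)
    have "(p + 0, 2 ^ n + 0) \<in> SG_plus" by (rule placed_G_verts[OF pl(3) cs(1)])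
    then show "(p, 2 ^ n) \<in> SG_plus" by simp
  qed (rule pos)
  then have "flux_top f n p 0 + flux_origin f p (2 ^ n) = 4"
    using laplacian_midpoints(2)[OF Suc.prems(1), of f] by simp
  then have "(f (p, 0) + f (p + 2 ^ n, 0) - 2 * f (p, 0 + 2 ^ n)) +
      (f (p + 2 ^ n, 2 ^ n) + f (p, 2 ^ n + 2 ^ n) - 2 * f (p, 2 ^ n)) = 4 * 5 ^ n"
    unfolding poisson_flux(3)[OF P_left] poisson_flux(1)[OF P_top] flux_sum_eq_4_iff .
  then have apex: "f (p, 2 ^ n + 2 ^ n) = 2 * 5 ^ Suc n"
    unfolding vals add_0 by simp
  from Suc.prems(2) consider "(x, y) \<in> G_verts n" | "(x - 2 ^ n, y) \<in> G_verts n" | "(x, y - 2 ^ n) \<in> G_verts n"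
    unfolding G_verts_Suc_iff by blast
  then show ?case
  proof cases
    case 1
    then show ?thesis using tent_Suc_pieces(1) left by simp
  next
    case 2
    then show ?thesis using tent_Suc_pieces(2)[OF 2] right[OF 2] by simp
  next
    case 3
    then show ?thesis
      using tent_Suc_pieces(3)[OF 3] poisson_imp_dirichlet[OF P_top 3, unfolded vals apex] by simp
  qed
qed

lemma infinite_tent_bottom: "0 \<le> x \<Longrightarrow> infinite_tent (x, 0) = 0"
proof -
  assume "0 \<le> x"
  have "(x, 0) \<in> cell (x, 0)" by (simp add: cell_def)
  then have "(x, 0) \<in> SG_plus"
    using axis_in_all_cells[OF \<open>0 \<le> x\<close>] unfolding SG_plus_eq_cells by blast
  then obtain n where n: "(x, 0) \<in> G_verts n" by (auto simp: SG_plus_def)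
  then show "infinite_tent (x, 0) = 0" using infinite_tent_eq_tent tent_bottom by simp
qed

lemma infinite_tent_row_1: "(x, 1) \<in> SG_plus \<Longrightarrow> infinite_tent (x, 1) = 2"
  using infinite_tent_eq_tent tent_row_1 by (auto simp: SG_plus_def)

lemma laplacian_infinite_tent:
  assumes "(x, y) \<in> SG_plus" "1 \<le> y"
  shows "laplacian infinite_tent (x, y) = 1"
proof -
  obtain n where n: "(x, y) \<in> noncorners n" using SG_plus_eventually_noncorner[of x y] assms by auto
  have "poisson infinite_tent n 0 0"
    by (rule dirichlet_imp_poisson[of _ _ _ _ 0 0 "2 * 5 ^ n"]) (simp add: infinite_tent_eq_tent flip: tent_def)
  then have "laplacian infinite_tent (0 + x, 0 + y) = 1"
    using poisson_iff_laplacian[OF placed_zero, THEN iffD1] n by blast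
  then show "laplacian infinite_tent (x, y) = 1" by simp
qed

lemma infinite_tent_unique:
  assumes "f \<in> extensional SG_plus"
    and "\<And>x. 0 \<le> x \<Longrightarrow> f (x, 0) = 0"
    and "\<And>x. 0 \<le> x \<Longrightarrow> (x, 1) \<in> SG_plus \<Longrightarrow> f (x, 1) = 2"
    and "\<And>x y. (x, y) \<in> SG_plus \<Longrightarrow> 1 \<le> y \<Longrightarrow> laplacian f (x, y) = 1"
  shows "f = infinite_tent"
proof (rule extensionalityI[of _ SG_plus])
  fix z
  assume "z \<in> SG_plus"
  then obtain n where n: "z \<in> G_verts n" by (auto simp: SG_plus_def)
  obtain x y where z: "z = (x, y)" by fastforce
  have "f (0 + x, y) = tent n (x, y)"
    by (rule tent_unique[OF assms(2-4) placed_zero n[unfolded z]])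
  then show "f z = infinite_tent z" using infinite_tent_eq_tent n z by simp
qed (use assms(1) in \<open>simp_all add: infinite_tent_def\<close>)

lemma u_tilde_eq_infinite_tent: "u_tilde = infinite_tent"
proof -
  define spec where "spec f \<longleftrightarrow> f \<in> SG_plus \<rightarrow>\<^sub>E UNIV \<and> (\<forall>x\<ge>0. f (x, 0) = 0) \<and>
     (\<forall>x\<ge>0. (x, 1) \<in> SG_plus \<longrightarrow> f (x, 1) = 2) \<and>
     (\<forall>x y. (x, y) \<in> SG_plus \<and> y \<ge> 1 \<longrightarrow> laplacian f (x, y) = 1)" for f :: "vertex \<Rightarrow> real"
  have "spec infinite_tent" unfolding spec_def
  proof (intro conjI)
    show "infinite_tent \<in> SG_plus \<rightarrow>\<^sub>E UNIV" by (simp add: infinite_tent_def PiE_def)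
  qed (use infinite_tent_bottom infinite_tent_row_1 laplacian_infinite_tent in blast)+
  moreover have "f = infinite_tent" if "spec f" for f
    by (rule infinite_tent_unique) (use that in \<open>auto simp: spec_def PiE_def\<close>)
  ultimately have "(THE f. spec f) = infinite_tent" by (rule the_equality)
  then show ?thesis unfolding u_tilde_def spec_def .
qed

section \<open>Divisible sandpiles\<close>

lemma adj_sym: "x \<sim> y \<longleftrightarrow> y \<sim> x"
  by (simp add: SG_adj_def insert_commute)

lemma laplacian_linear:
  "laplacian (\<lambda>z. f z + c * g z) x = laplacian f x + c * laplacian g x"
  unfolding laplacian_def sum.distrib sum_distrib_left[symmetric] by (simp add: algebra_simps)

lemma odometer_after_Suc:
  "odometer_after h \<mu> s (Suc j) y =
     odometer_after h \<mu> s j y + excess h (sand_after h \<mu> s j) (s j) * of_bool (y = s j)"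
proof -
  have "{i. i < Suc j \<and> s i = y} = {i. i < j \<and> s i = y} \<union> (if s j = y then {j} else {})"
    by (auto simp: less_Suc_eq)
  then show ?thesis by (auto simp: odometer_after_def)
qed

lemma odometer_after_0: "odometer_after h \<mu> s 0 y = 0"
  by (simp add: odometer_after_def)

lemma sand_after_eq: "sand_after h \<mu> s j z = \<mu> z + laplacian (odometer_after h \<mu> s j) z"
proof (induction j arbitrary: z)
  case 0
  show ?case by (simp add: odometer_after_0 laplacian_def)
next
  case (Suc j)
  have "odometer_after h \<mu> s (Suc j) = (\<lambda>z. odometer_after h \<mu> s j z +
      excess h (sand_after h \<mu> s j) (s j) * of_bool (z = s j))"
    by (rule ext) (rule odometer_after_Suc)
  then show ?case by (simp add: topple_def Suc laplacian_linear)
qed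

lemma odometer_after_mono: "i \<le> j \<Longrightarrow> odometer_after h \<mu> s i y \<le> odometer_after h \<mu> s j y"
  by (rule lift_Suc_mono_le[of "\<lambda>j. odometer_after h \<mu> s j y"])
    (simp_all add: odometer_after_Suc excess_def)

text \<open>A legal toppling at \<open>x\<close> brings \<open>x\<close> exactly to the height \<open>h x\<close>, while \<open>w\<close> brings it to at most
  \<open>h x\<close>. If \<open>w\<close> dominates the odometer at the neighbours of \<open>x\<close>, then \<open>w\<close> has to emit at least as
  much from \<open>x\<close>.\<close>
lemma least_action:
  assumes s: "range s \<subseteq> SG"
    and nonneg: "\<And>y. y \<in> SG \<Longrightarrow> 0 \<le> w y"
    and stable: "\<And>y. y \<in> SG \<Longrightarrow> \<mu> y + laplacian w y \<le> h y"
    and "y \<in> SG"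
  shows "odometer_after h \<mu> s j y \<le> w y"
  using \<open>y \<in> SG\<close>
proof (induction j arbitrary: y)
  case 0
  then show ?case by (simp add: odometer_after_0 nonneg)
next
  case (Suc j)
  define x u where "x = s j" and "u = odometer_after h \<mu> s j"
  have x: "x \<in> SG" using s by (auto simp: x_def)
  have IH: "u z \<le> w z" if "z \<in> SG" for z using Suc.IH that by (simp add: u_def)
  have step: "odometer_after h \<mu> s (Suc j) y = u y + excess h (sand_after h \<mu> s j) x * of_bool (y = x)"
    by (simp add: odometer_after_Suc x_def u_def)
  show ?case
  proof (cases "y = x \<and> h x < sand_after h \<mu> s j x")
    case False
    then show ?thesis using step IH[OF Suc.prems] by (auto simp: excess_def)
  next
    case True
    define e where "e = \<mu> x + laplacian u x - h x"
    have e: "excess h (sand_after h \<mu> s j) x = e"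
      using True by (simp add: excess_def sand_after_eq u_def e_def)
    have "(\<Sum>y | x \<sim> y. u y) \<le> (\<Sum>y | x \<sim> y. w y)"
      using IH SG_adj_step by (intro sum_mono) simp
    then have "e + u x \<le> \<mu> x + laplacian w x + w x - h x"
      by (simp add: e_def laplacian_def)
    also have "\<dots> \<le> w x" using stable[OF x] by simp
    finally show ?thesis using step e True by simp
  qed
qed

text \<open>If the limiting mass exceeded \<open>h x\<close>, so would the mass at \<open>x\<close> from some step on. But it is at most
  \<open>h x\<close> immediately after each toppling of \<open>x\<close>.\<close>
lemma odometer_limit_stable:
  assumes s: "toppling_sequence s" and x: "x \<in> SG"
    and lim: "\<And>y. y \<in> SG \<Longrightarrow> (\<lambda>j. odometer_after h \<mu> s j y) \<longlonglongrightarrow> u y"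
  shows "\<mu> x + laplacian u x \<le> h x"
proof (rule ccontr)
  assume "\<not> \<mu> x + laplacian u x \<le> h x"
  then have unstable: "h x < \<mu> x + laplacian u x" by (rule not_le_imp_less)
  have "(\<lambda>j. \<mu> x + laplacian (odometer_after h \<mu> s j) x) \<longlonglongrightarrow> \<mu> x + laplacian u x"
    unfolding laplacian_def using lim x SG_adj_step by (intro tendsto_intros) auto
  then have "(\<lambda>j. sand_after h \<mu> s j x) \<longlonglongrightarrow> \<mu> x + laplacian u x"
    by (simp add: sand_after_eq)
  then have "\<forall>\<^sub>F j in sequentially. h x < sand_after h \<mu> s j x"
    using unstable by (rule order_tendstoD)
  then obtain N where N: "\<And>j. N \<le> j \<Longrightarrow> h x < sand_after h \<mu> s j x"
    by (auto simp: eventually_sequentially)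
  obtain j where j: "N \<le> j" "s j = x"
    using s x unfolding toppling_sequence_def infinite_nat_iff_unbounded_le by blast
  have "laplacian (\<lambda>w. of_bool (w = x)) x = - 1"
    using not_adj_self[of x] by (auto simp: laplacian_def intro!: sum.neutral)
  then have "sand_after h \<mu> s (Suc j) x \<le> h x"
    using N[OF j(1)] by (simp add: topple_def j(2) excess_def)
  then show False using N[of "Suc j"] j(1) by simp
qed

lemma axis_adj:
  assumes "0 \<le> x"
  shows "(x, 0) \<sim> (x + 1, 0)"
  using axis_in_all_cells[OF assms] unfolding SG_adj_iff SG_plus_edges_iff
  by (intro disjI1 conjI bexI[of _ "(x, 0)"]) (simp_all add: cell_def)

lemma zero_in_SG: "(0, 0) \<in> SG"
  using zero_in_G_verts unfolding SG_def SG_plus_def by blast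

lemma maximum_propagates:
  assumes x: "x \<in> SG" and lap: "0 \<le> laplacian v x" and le: "\<And>y. x \<sim> y \<Longrightarrow> v y \<le> v x"
    and y: "x \<sim> y"
  shows "v y = v x"
proof -
  have card: "card {y. x \<sim> y} = 4" using card_nbrs[OF x] .
  then have fin: "finite {y. x \<sim> y}" using card.infinite by force
  have "(\<Sum>y | x \<sim> y. v x - v y) = - 4 * laplacian v x"
    by (simp add: sum_subtractf card laplacian_def)
  then have "(\<Sum>y | x \<sim> y. v x - v y) \<le> 0" using lap by simp
  moreover have "0 \<le> (\<Sum>y | x \<sim> y. v x - v y)" using le by (intro sum_nonneg) simp
  ultimately have "(\<Sum>y | x \<sim> y. v x - v y) = 0" by simp
  then have "\<forall>y\<in>{y. x \<sim> y}. v x - v y = 0"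
    by (subst (asm) sum_nonneg_eq_0_iff[OF fin]) (use le in simp_all)
  then have "v x - v y = 0" using y by blast
  then show ?thesis by simp
qed

text \<open>The graph is connected and infinite, so a positive maximum would spread beyond any finite set.
  It suffices to spread it along one route: down to the origin, by \<open>SG_pred\<close>, and from there along the \<open>x\<close>-axis.\<close>
lemma maximum_principle:
  assumes fin: "finite S" and S: "S \<subseteq> SG"
    and sub: "\<And>x. x \<in> S \<Longrightarrow> 0 \<le> laplacian v x"
    and out: "\<And>x. x \<in> SG - S \<Longrightarrow> v x \<le> 0"
    and z: "z \<in> SG"
  shows "v z \<le> 0"
proof (rule ccontr)
  assume "\<not> v z \<le> 0"
  then have zS: "z \<in> S" using out[of z] z by blast
  define M where "M = Max (v ` S)"
  have M_ge: "v x \<le> M" if "x \<in> S" for x unfolding M_def using fin that by simp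
  have M_pos: "0 < M" using \<open>\<not> v z \<le> 0\<close> M_ge[OF zS] by simp
  have M_ge': "v x \<le> M" if "x \<in> SG" for x using M_ge out[of x] M_pos that by (cases "x \<in> S") auto
  have spread: "y \<in> S \<and> v y = M" if "x \<in> S" "v x = M" "x \<sim> y" for x y
  proof -
    have "v y = v x"
      by (rule maximum_propagates) (use that S sub M_ge' SG_adj_step in auto)
    moreover have "y \<in> SG" using SG_adj_step that(3) by blast
    ultimately show ?thesis using out[of y] that M_pos by force
  qed
  have "M \<in> v ` S" unfolding M_def using fin zS by (intro Max_in) auto
  then obtain x where x: "x \<in> S" "v x = M" by auto
  have origin: "(0, 0) \<in> S \<and> v (0, 0) = M"
    using x
  proof (induction "nat (\<bar>fst x\<bar> + \<bar>snd x\<bar>)" arbitrary: x rule: less_induct)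
    case less
    show ?case
    proof (cases "x = (0, 0)")
      case False
      then obtain w where w: "w \<sim> x" "\<bar>fst w\<bar> + \<bar>snd w\<bar> = \<bar>fst x\<bar> + \<bar>snd x\<bar> - 1"
        using SG_pred less.prems(1) S by blast
      then have "w \<in> S \<and> v w = M" using spread less.prems adj_sym by blast
      moreover have "nat (\<bar>fst w\<bar> + \<bar>snd w\<bar>) < nat (\<bar>fst x\<bar> + \<bar>snd x\<bar>)" using w(2) by linarith
      ultimately show ?thesis using less.hyps by blast
    qed (use less.prems in simp)
  qed
  have "(int i, 0) \<in> S \<and> v (int i, 0) = M" for i
  proof (induction i)
    case (Suc i)
    then show ?case using spread[of "(int i, 0)" "(int i + 1, 0)"] axis_adj[of "int i"]
      by (simp add: add.commute)
  qed (use origin in simp)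
  then have "range (\<lambda>i. (int i, 0)) \<subseteq> S" by blast
  moreover have "infinite (range (\<lambda>i :: nat. (int i, 0 :: int)))"
    by (rule range_inj_infinite) (auto simp: inj_def)
  ultimately show False using fin finite_subset by blast
qed

text \<open>Without a toppling sequence the description of the odometer as the common limit would be
  satisfied by every number.\<close>
lemma toppling_sequence_exists: "\<exists>s. toppling_sequence s"
proof -
  define s where "s = (\<lambda>j. from_nat_into SG (fst (prod_decode j)))"
  have ne: "SG \<noteq> {}" using zero_in_SG by blast
  have "infinite {j. s j = x}" if x: "x \<in> SG" for x
  proof -
    obtain i where i: "from_nat_into SG i = x"
      using from_nat_into_surj[OF countableI_type x] by blast
    have "range (\<lambda>m. prod_encode (i, m)) \<subseteq> {j. s j = x}" by (auto simp: s_def i)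
    moreover have "infinite (range (\<lambda>m. prod_encode (i, m)))"
      by (rule range_inj_infinite) (auto simp: inj_def)
    ultimately show ?thesis using finite_subset by blast
  qed
  moreover have "range s \<subseteq> SG" using from_nat_into[OF ne] by (auto simp: s_def)
  ultimately show ?thesis unfolding toppling_sequence_def by blast
qed

text \<open>The obstacle problem. Least action gives an upper bound; the maximum principle, applied to the
  difference from the limiting odometer on the support of \<open>w\<close>, shows that the bound is
  attained.\<close>
lemma odometer_eqI:
  assumes nonneg: "\<And>x. x \<in> SG \<Longrightarrow> 0 \<le> w x"
    and fin: "finite {x \<in> SG. 0 < w x}"
    and stable: "\<And>x. x \<in> SG \<Longrightarrow> \<mu> x + laplacian w x \<le> h x"
    and full: "\<And>x. x \<in> SG \<Longrightarrow> 0 < w x \<Longrightarrow> \<mu> x + laplacian w x = h x"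
    and y: "y \<in> SG"
  shows "odometer h \<mu> y = w y"
proof -
  have lim: "(\<lambda>j. odometer_after h \<mu> s j y) \<longlonglongrightarrow> w y" if s: "toppling_sequence s" "y \<in> SG" for s y
  proof -
    have le: "odometer_after h \<mu> s j x \<le> w x" if "x \<in> SG" for j x
      by (rule least_action) (use s nonneg stable that in \<open>auto simp: toppling_sequence_def\<close>)
    define u where "u x = lim (\<lambda>j. odometer_after h \<mu> s j x)" for x
    have u: "(\<lambda>j. odometer_after h \<mu> s j x) \<longlonglongrightarrow> u x" if "x \<in> SG" for x
    proof -
      have "\<exists>l. (\<lambda>j. odometer_after h \<mu> s j x) \<longlonglongrightarrow> l"
        using incseq_convergent[of "\<lambda>j. odometer_after h \<mu> s j x" "w x"] le[OF that] odometer_after_mono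
        by (metis incseq_def)
      then show ?thesis unfolding u_def using convergent_LIMSEQ_iff convergent_def by blast
    qed
    have u_le: "u x \<le> w x" if "x \<in> SG" for x
      using LIMSEQ_le_const2[OF u[OF that]] le[OF that] by blast
    have u_nonneg: "0 \<le> u x" if "x \<in> SG" for x
      using LIMSEQ_le_const[OF u[OF that]] odometer_after_mono[of 0 _ h \<mu> s x]
      by (auto simp: odometer_after_0)
    have "w y - u y \<le> 0"
    proof (rule maximum_principle[OF fin, of "\<lambda>x. w x - u x"])
      fix x assume x: "x \<in> {x \<in> SG. 0 < w x}"
      have "\<mu> x + laplacian u x \<le> h x" by (rule odometer_limit_stable[OF s(1)]) (use x u in auto)
      moreover have "\<mu> x + laplacian w x = h x" using full x by simp
      moreover have "laplacian (\<lambda>x. w x - u x) x = laplacian w x - laplacian u x"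
        using laplacian_linear[of w "- 1" u x] by simp
      ultimately show "0 \<le> laplacian (\<lambda>x. w x - u x) x" by simp
    next
      fix x assume "x \<in> SG - {x \<in> SG. 0 < w x}"
      then show "w x - u x \<le> 0" using u_nonneg[of x] nonneg[of x] by auto
    qed (use s(2) in auto)
    then have "u y = w y" using u_le[OF s(2)] by simp
    then show ?thesis using u[OF s(2)] by simp
  qed
  show ?thesis unfolding odometer_def
  proof (rule the_equality)
    show "\<forall>s. toppling_sequence s \<longrightarrow> (\<lambda>j. odometer_after h \<mu> s j y) \<longlonglongrightarrow> w y"
      using lim y by blast
  next
    fix l
    assume "\<forall>s. toppling_sequence s \<longrightarrow> (\<lambda>j. odometer_after h \<mu> s j y) \<longlonglongrightarrow> l"
    then show "l = w y" using lim y toppling_sequence_exists LIMSEQ_unique by blast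
  qed
qed

section \<open>The odometer\<close>

text \<open>The rotated tent with its apex at the origin, reflected to \<open>SG\<^sup>-\<close> and extended by \<open>0\<close>. The condition
  describes the ball for points of \<open>SG\<close>.\<close>
definition peak :: "nat \<Rightarrow> vertex \<Rightarrow> real" where
  "peak k = (\<lambda>(x, y). if \<bar>x\<bar> + \<bar>y\<bar> \<le> 2 ^ k then tent k (\<psi> k (\<bar>x\<bar>, \<bar>y\<bar>)) else 0)"

lemma peak_uminus: "peak k (- z) = peak k z"
  by (cases z) (simp add: peak_def)

lemma peak_eq_tent: "(x, y) \<in> G_verts k \<Longrightarrow> peak k (x, y) = tent k (y, 2 ^ k - x - y)"
  using G_verts_bound[of x y k] by (simp add: peak_def \<psi>_def)

lemma SG_cases:
  assumes "z \<in> SG"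
  obtains x y where "(x, y) \<in> SG_plus" "z = (x, y) \<or> z = - (x, y)"
proof -
  from assms consider "z \<in> SG_plus" | w where "w \<in> SG_plus" "z = - w"
    by (auto simp: SG_def)
  then show thesis by cases (metis that surj_pair)+
qed

lemma SG_abs:
  assumes "(x, y) \<in> SG"
  shows "(\<bar>x\<bar>, \<bar>y\<bar>) \<in> SG_plus"
proof -
  obtain a b where "(a, b) \<in> SG_plus" "(x, y) = (a, b) \<or> (x, y) = - (a, b)"
    using assms by (rule SG_cases)
  then show ?thesis using SG_plus_nonneg[of a b] by auto
qed

lemma peak_sign:
  assumes "(x, y) \<in> SG"
  shows "\<bar>x\<bar> + \<bar>y\<bar> < 2 ^ k \<Longrightarrow> 0 < peak k (x, y)"
    and "2 ^ k \<le> \<bar>x\<bar> + \<bar>y\<bar> \<Longrightarrow> peak k (x, y) = 0"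
proof -
  have in_G: "(\<bar>y\<bar>, 2 ^ k - \<bar>x\<bar> - \<bar>y\<bar>) \<in> G_verts k" if "\<bar>x\<bar> + \<bar>y\<bar> \<le> 2 ^ k"
    using dirichlet_rotate(1) SG_plus_bounded_in_G_verts[OF SG_abs[OF assms]] that by blast
  show "0 < peak k (x, y)" if "\<bar>x\<bar> + \<bar>y\<bar> < 2 ^ k"
    using tent_pos[OF in_G] that by (simp add: peak_def \<psi>_def)
  show "peak k (x, y) = 0" if le: "2 ^ k \<le> \<bar>x\<bar> + \<bar>y\<bar>"
  proof (cases "\<bar>x\<bar> + \<bar>y\<bar> = 2 ^ k")
    case True
    then have eq: "2 ^ k - \<bar>x\<bar> - \<bar>y\<bar> = 0" by simp
    have "peak k (x, y) = tent k (\<bar>y\<bar>, 2 ^ k - \<bar>x\<bar> - \<bar>y\<bar>)"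
      using True by (simp add: peak_def \<psi>_def)
    also have "\<dots> = 0"
      unfolding eq using True in_G[unfolded eq] by (intro tent_bottom) simp
    finally show ?thesis .
  qed (use le in \<open>simp add: peak_def\<close>)
qed

lemma peak_poisson: "poisson (peak k) k 0 0"
  by (rule dirichlet_imp_poisson[of _ _ _ _ "2 * 5 ^ k" 0 0])
    (simp add: peak_eq_tent tent_def dirichlet_rotate(2))

lemma peak_corners: "peak k (0, 0) = 2 * 5 ^ k" "peak k (2 ^ k, 0) = 0" "peak k (0, 2 ^ k) = 0"
  using zero_in_G_verts G_corners by (simp_all add: peak_eq_tent tent_corners)

text \<open>Substituting the corner values \<open>2\<cdot>5\<^sup>k, 0, 0\<close> into the flux law turns \<open>(3/5)\<^sup>k 5\<^sup>k\<close> into \<open>3\<^sup>k\<close>.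
  The constant \<open>3\<^sup>k\<^sup>+\<^sup>1\<close> of the initial mass appears here.\<close>
lemma peak_flux:
  "flux_origin (peak k) 0 0 = 2 - 2 * 3 ^ Suc k" "flux_right (peak k) k 0 0 = 2"
  "flux_top (peak k) k 0 0 = 2"
proof -
  have T: "(3 / 5) ^ k * 5 ^ k = (3 :: real) ^ k" by (simp flip: power_mult_distrib)
  show "flux_origin (peak k) 0 0 = 2 - 2 * 3 ^ Suc k" "flux_right (peak k) k 0 0 = 2"
    "flux_top (peak k) k 0 0 = 2"
    unfolding poisson_flux[OF peak_poisson] add_0 peak_corners
    using T by (simp_all add: algebra_simps)
qed

lemma initial_mass_uminus: "initial_mass k (- z) = initial_mass k z"
  by (cases z) (simp add: initial_mass_def)

text \<open>Away from the origin there are three regions: inside \<open>G\<^sub>k\<close> the Laplacian is \<open>1\<close>, at the two far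
  corners it is \<open>1/2\<close> because only the pair of neighbours in \<open>G\<^sub>k\<close> contributes, and further out it vanishes
  because \<open>peak k\<close> is already \<open>0\<close> at distance \<open>2\<^sup>k\<close>.\<close>
lemma stable_SG_plus:
  assumes "(x, y) \<in> SG_plus"
  shows "initial_mass k (x, y) + laplacian (peak k) (x, y) \<le> 1"
    and "x + y < 2 ^ k \<Longrightarrow> initial_mass k (x, y) + laplacian (peak k) (x, y) = 1"
proof -
  have nonneg: "0 \<le> x" "0 \<le> y" using SG_plus_nonneg[OF assms] by auto
  have SG: "(x, y) \<in> SG" using assms by (simp add: SG_def)
  let ?m = "initial_mass k (x, y) + laplacian (peak k) (x, y)"
  consider "(x, y) = (0, 0)" | "(x, y) \<in> noncorners k" | "(x, y) = (2 ^ k, 0)" | "(x, y) = (0, 2 ^ k)"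
    | "2 ^ k < x + y"
    using SG_plus_bounded_in_G_verts[OF assms, of k] unfolding noncorners_def by fastforce
  then have "?m \<le> 1 \<and> (x + y < 2 ^ k \<longrightarrow> ?m = 1)"
  proof cases
    case 1
    have "peak k (-1, 0) = peak k (1, 0)" "peak k (0, -1) = peak k (0, 1)"
      using peak_uminus[of k "(1, 0)"] peak_uminus[of k "(0, 1)"] by simp_all
    then have "4 * laplacian (peak k) (0, 0) = 2 * flux_origin (peak k) 0 0"
      by (simp add: laplacian_def nbrs_zero flux_origin_def)
    then show ?thesis using 1 by (simp add: peak_flux initial_mass_def)
  next
    case 2
    then have "laplacian (peak k) (0 + x, 0 + y) = 1"
      using peak_poisson poisson_iff_laplacian[OF placed_zero, THEN iffD1] by blast
    moreover have "(x, y) \<noteq> (0, 0)" using 2 by (simp add: noncorners_def)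
    then have "initial_mass k (x, y) = 0" by (simp add: initial_mass_def)
    ultimately show ?thesis by simp
  next
    case 3
    have "peak k (2 ^ k + 1, 0) = 0" "peak k (2 ^ k, 1) = 0" by (simp_all add: peak_def)
    then have "4 * laplacian (peak k) (x, y) = 2"
      using 3 laplacian_midpoints(1)[OF placed_zero, of "peak k" k]
      by (simp add: peak_flux flux_origin_def peak_corners)
    then show ?thesis using 3 by (simp add: initial_mass_def)
  next
    case 4
    have "peak k (0, 2 ^ k + 1) = 0" "peak k (1, 2 ^ k) = 0" by (simp_all add: peak_def)
    then have "4 * laplacian (peak k) (x, y) = 2"
      using 4 laplacian_midpoints(2)[OF placed_zero, of "peak k" k]
      by (simp add: peak_flux flux_origin_def peak_corners)
    then show ?thesis using 4 by (simp add: initial_mass_def)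
  next
    case 5
    have "peak k w = 0" if "(x, y) \<sim> w" for w
    proof -
      have "w \<in> SG" "2 ^ k \<le> \<bar>fst w\<bar> + \<bar>snd w\<bar>"
        using SG_adj_step[OF that] 5 nonneg by auto
      then show ?thesis using peak_sign(2)[of "fst w" "snd w" k] by simp
    qed
    moreover have "peak k (x, y) = 0" using peak_sign(2)[OF SG] 5 nonneg by simp
    ultimately have "laplacian (peak k) (x, y) = 0" by (simp add: laplacian_def)
    moreover have "(x, y) \<noteq> (0, 0)" using 5 by auto
    then have "initial_mass k (x, y) = 0" by (simp add: initial_mass_def)
    ultimately show ?thesis using 5 by simp
  qed
  then show "?m \<le> 1" "x + y < 2 ^ k \<Longrightarrow> ?m = 1" by blast+
qed

lemma stable_SG:
  assumes "(x, y) \<in> SG"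
  shows "initial_mass k (x, y) + laplacian (peak k) (x, y) \<le> 1"
    and "\<bar>x\<bar> + \<bar>y\<bar> < 2 ^ k \<Longrightarrow> initial_mass k (x, y) + laplacian (peak k) (x, y) = 1"
proof -
  obtain a b where ab: "(a, b) \<in> SG_plus" "(x, y) = (a, b) \<or> (x, y) = - (a, b)"
    using assms by (rule SG_cases)
  have "laplacian (peak k) (- (a, b)) = laplacian (peak k) (a, b)"
    unfolding laplacian_uminus peak_uminus ..
  then have eq: "initial_mass k (x, y) + laplacian (peak k) (x, y) =
      initial_mass k (a, b) + laplacian (peak k) (a, b)"
    using ab(2) initial_mass_uminus[of k "(a, b)"] by metis
  have abs: "\<bar>x\<bar> + \<bar>y\<bar> = a + b" using ab(2) SG_plus_nonneg[OF ab(1)] by auto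
  show "initial_mass k (x, y) + laplacian (peak k) (x, y) \<le> 1"
    unfolding eq by (rule stable_SG_plus(1)[OF ab(1)])
  show "\<bar>x\<bar> + \<bar>y\<bar> < 2 ^ k \<Longrightarrow> initial_mass k (x, y) + laplacian (peak k) (x, y) = 1"
    unfolding eq abs by (rule stable_SG_plus(2)[OF ab(1)])
qed

lemma peak_pos_iff:
  assumes "(x, y) \<in> SG"
  shows "0 < peak k (x, y) \<longleftrightarrow> \<bar>x\<bar> + \<bar>y\<bar> < 2 ^ k"
  using peak_sign[OF assms, of k] by (cases "\<bar>x\<bar> + \<bar>y\<bar> < 2 ^ k") auto

lemma odometer_eq_peak:
  assumes "z \<in> SG"
  shows "odometer (\<lambda>_. 1) (initial_mass k) z = peak k z"
proof (rule odometer_eqI[OF _ _ _ _ assms])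
  fix z assume z: "z \<in> SG"
  obtain x y where xy: "z = (x, y)" by fastforce
  show "0 \<le> peak k z"
    using peak_sign[of x y k] z xy by (cases "\<bar>x\<bar> + \<bar>y\<bar> < 2 ^ k") auto
  show "initial_mass k z + laplacian (peak k) z \<le> 1"
    using stable_SG(1) z xy by simp
  show "initial_mass k z + laplacian (peak k) z = 1" if "0 < peak k z"
    using stable_SG(2) peak_pos_iff z xy that by simp
next
  have "{z \<in> SG. 0 < peak k z} \<subseteq> {- (2 ^ k)..2 ^ k} \<times> {- (2 ^ k)..2 ^ k}"
    by (auto simp: peak_pos_iff)
  then show "finite {z \<in> SG. 0 < peak k z}" by (rule finite_subset) simp
qed

theorem theorem5p12:
  fixes k :: nat
  shows "(\<forall>(x, y) \<in> SG. odometer (\<lambda>_. 1) (initial_mass k) (x, y) =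
            (if (x, y) \<in> SG_ball (2 ^ k) then (u_tilde \<circ> \<psi> k) (\<bar>x\<bar>, \<bar>y\<bar>) else 0))
       \<and> sandpile_cluster (\<lambda>_. 1) (initial_mass k) = SG_ball (2 ^ k - 1)"
proof (intro conjI ballI)
  fix z assume z: "z \<in> SG"
  obtain x y where xy: "z = (x, y)" by fastforce
  have "u_tilde (\<psi> k (\<bar>x\<bar>, \<bar>y\<bar>)) = peak k (x, y)" if le: "\<bar>x\<bar> + \<bar>y\<bar> \<le> 2 ^ k"
  proof -
    have "(\<bar>y\<bar>, 2 ^ k - \<bar>x\<bar> - \<bar>y\<bar>) \<in> G_verts k"
      using dirichlet_rotate(1) SG_plus_bounded_in_G_verts SG_abs z xy le by blast
    then show ?thesis using le by (simp add: u_tilde_eq_infinite_tent infinite_tent_eq_tent peak_def \<psi>_def)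
  qed
  moreover have "peak k (x, y) = 0" if "\<not> \<bar>x\<bar> + \<bar>y\<bar> \<le> 2 ^ k"
    using that by (simp add: peak_def)
  ultimately show "case z of (x, y) \<Rightarrow> odometer (\<lambda>_. 1) (initial_mass k) (x, y) =
      (if (x, y) \<in> SG_ball (2 ^ k) then (u_tilde \<circ> \<psi> k) (\<bar>x\<bar>, \<bar>y\<bar>) else 0)"
    using z by (simp add: xy odometer_eq_peak SG_ball_def)
next
  have "int (2 ^ k - 1) = 2 ^ k - 1" by (simp add: of_nat_diff)
  then have "SG_ball (2 ^ k - 1) = {(x, y). (x, y) \<in> SG \<and> \<bar>x\<bar> + \<bar>y\<bar> < 2 ^ k}"
    unfolding SG_ball_def by auto
  then show "sandpile_cluster (\<lambda>_. 1) (initial_mass k) = SG_ball (2 ^ k - 1)"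
    by (auto simp: sandpile_cluster_def odometer_eq_peak peak_pos_iff)
qed

end
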